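(* Let $L\geqslant2$ be an integer, $f\in\mathbb{Z}^2$ a nonzero vector, $\tilde\lambda$ a positive integer, and let $\lambda^*,\mu^*\in\mathbb{R}$ satisfy $\mu^*>0$, $\lambda^*+2\mu^*>0$ and $\lambda^*+\mu^*\neq0$. Let $A^{km}_{nr}=A^{km}_{nr}(t)\in C^L(\mathbb{R};\mathbb{R})$, $1\leqslant k,m,n,r\leqslant2$, and for $w:\mathbb{R}\times\mathbb{T}^2\to\mathbb{C}^2$ put $(A(\nabla^2w))_k=\sum_{m,n,r}A^{km}_{nr}\,\partial_{x_n}\partial_{x_r}w_m$. Let $f^\perp=(-f_2,f_1)$. Suppose that, for all indices $k,m,n,r$, $\|A^{km}_{nr}\|_{C^0_t}\leqslant C\varepsilon$ for some constant $C>0$, and $\|A^{km}_{nr}\|_{C^N_t}\leqslant\mathring{A}\,\tilde\lambda_A^N$ for $1\leqslant N\leqslant L$, for some constants $0<\mathring{A}\leqslant1$ and $\tilde\lambda_A\geqslant1$. Then there exists $\varepsilon_2^*=\varepsilon_2^*(\lambda^*,\mu^*,C)>0$ such that, for any $0<\varepsilon<\varepsilon_2^*$, there exist real-valued functions $a_A\in C^L(\mathbb{R})$ and $c_A\in C^{L+1}(\mathbb{R})$, with $c_A(0)=0$, for which $$\|a_A\|_{C^0_t}\lesssim_{\lambda^*,\mu^*,C}\varepsilon,\quad \|a_A\|_{C^0_t}\leqslant\tfrac1{10},\qquad \|a_A\|_{C^N_t}\lesssim_{\lambda^*,\mu^*,C,L}\mathring{A}\,\tilde\lambda_A^N,\quad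 1\leqslant N\leqslant L,$$ $$\big\|\partial_tc_A-(\lambda^*+2\mu^* )^{1/2}|f|\big\|_{C^0_t}\lesssim_{\lambda^*,\mu^*,C}\varepsilon|f|,\qquad \|\partial_t^Nc_A\|_{C^0_t}\lesssim_{\lambda^*,\mu^*,C,L}\mathring{A}\,\tilde\lambda_A^{N-1}|f|,\quad 2\leqslant N\leqslant L.$$ Moreover, the function $$w_{A,f}=(f+a_A(t)f^\perp)e^{i\xi_{A,f}},\qquad \xi_{A,f}=\tilde\lambda\,(f\cdot x-c_A(t)),$$ which is well defined on $\mathbb{R}\times\mathbb{T}^2$, satisfies $$\partial_{tt}w_{A,f}-\mu^*\Delta w_{A,f}-(\lambda^*+\mu^* )\nabla(\operatorname{div}w_{A,f})+A(\nabla^2w_{A,f})=\Big(-i\tilde\lambda\,\partial_{tt}c_A\,f+\big(\partial_{tt}a_A-i\tilde\lambda\,\partial_{tt}c_A\,a_A-2i\tilde\lambda\,\partial_tc_A\,\partial_ta_A\big)f^\perp\Big)e^{i\xi_{A,f}}.$$ Consequently the complex conjugate $\overline{w_{A,f}}$ satisfies the complex conjugate of this identity (all the coefficients on the left-hand side being real), so that $w_{A,f}+\overline{w_{A,f}}=2\,\mathrm{Re}\,w_{A,f}$ is a real-valued approximate solution of the equation $\partial_{tt}w-\mu^*\Delta w-(\lambda^*+\mu^* )\nabla(\operatorname{div}w)+A(\nabla^2w)=0$.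
   Context: $\mathbb{T}^2=[-\pi,\pi]^2$ with periodic boundary conditions. $\|\cdot\|_{C^N_t}$ is the $C^N(\mathbb{R})$ norm in $t$ (sum of the sup norms of derivatives of order at most $N$). $X\lesssim_{\kappa}Y$ means $X\leqslant C'Y$ with a constant $C'>0$ depending only on the listed quantities $\kappa$. "Approximate solution" means that $2\,\mathrm{Re}\,w_{A,f}$ satisfies the equation up to the right-hand side given by twice the real part of the displayed right-hand side. *)

theory Defs
  imports "HOL-Analysis.Analysis"
begin

definition CN_fun :: "nat \<Rightarrow> (real \<Rightarrow> real) \<Rightarrow> bool" where
  "CN_fun N g \<longleftrightarrow>
     (\<forall>i<N. (deriv ^^ i) g differentiable_on UNIV) \<and> continuous_on UNIV ((deriv ^^ N) g)"

text \<open>The norm is extended-real valued, so that an upper bound on it entails boundedness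
  (a supremum in the reals would be meaningless for an unbounded function).\<close>

definition CN_norm :: "nat \<Rightarrow> (real \<Rightarrow> real) \<Rightarrow> ereal" where
  "CN_norm N g = (\<Sum>i\<le>N. SUP t. ereal \<bar>(deriv ^^ i) g t\<bar>)"

text \<open>Functions on \<open>\<real> \<times> \<bbbT>\<^sup>2\<close> are functions of a time and a point of \<open>\<real>\<^sup>2\<close> that are
  \<open>2\<pi>\<close>-periodic in both space coordinates.  The type \<open>'a\<close> is \<open>real\<close> or \<open>complex\<close>.\<close>

definition torus_fun :: "(real \<Rightarrow> real^2 \<Rightarrow> 'b) \<Rightarrow> bool" where
  "torus_fun w \<longleftrightarrow> (\<forall>t x j. w t (x + (2 * pi) *\<^sub>R axis j 1) = w t x)"

definition pdt :: "(real \<Rightarrow> real^2 \<Rightarrow> 'b::real_normed_vector) \<Rightarrow> real \<Rightarrow> real^2 \<Rightarrow> 'b" where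
  "pdt w t x = vector_derivative (\<lambda>s. w s x) (at t)"

definition pdx :: "2 \<Rightarrow> (real^2 \<Rightarrow> 'b::real_normed_vector) \<Rightarrow> real^2 \<Rightarrow> 'b" where
  "pdx n u x = vector_derivative (\<lambda>s. u (x + s *\<^sub>R axis n 1)) (at 0)"

definition divergence :: "(real^2 \<Rightarrow> 'a::real_normed_vector^2) \<Rightarrow> real^2 \<Rightarrow> 'a" where
  "divergence v x = (\<Sum>m\<in>UNIV. pdx m (\<lambda>y. v y $ m) x)"

definition gradient :: "(real^2 \<Rightarrow> 'a::real_normed_vector) \<Rightarrow> real^2 \<Rightarrow> 'a^2" where
  "gradient u x = (\<chi> k. pdx k u x)"

definition laplacian :: "(real^2 \<Rightarrow> 'a::real_normed_vector^2) \<Rightarrow> real^2 \<Rightarrow> 'a^2" where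
  "laplacian v x = (\<chi> k. \<Sum>n\<in>UNIV. pdx n (pdx n (\<lambda>y. v y $ k)) x)"

text \<open>\<open>A k m n r\<close> is the coefficient with upper indices \<open>k m\<close> and lower indices \<open>n r\<close>.\<close>

definition A_hess ::
  "(2 \<Rightarrow> 2 \<Rightarrow> 2 \<Rightarrow> 2 \<Rightarrow> real \<Rightarrow> real) \<Rightarrow> (real \<Rightarrow> real^2 \<Rightarrow> 'a::real_normed_vector^2)
    \<Rightarrow> real \<Rightarrow> real^2 \<Rightarrow> 'a^2" where
  "A_hess A w t x =
     (\<chi> k. \<Sum>m\<in>UNIV. \<Sum>n\<in>UNIV. \<Sum>r\<in>UNIV. A k m n r t *\<^sub>R pdx n (pdx r (\<lambda>y. w t y $ m)) x)"

definition wave_op ::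
  "real \<Rightarrow> real \<Rightarrow> (2 \<Rightarrow> 2 \<Rightarrow> 2 \<Rightarrow> 2 \<Rightarrow> real \<Rightarrow> real) \<Rightarrow> (real \<Rightarrow> real^2 \<Rightarrow> 'a::real_normed_vector^2)
    \<Rightarrow> real \<Rightarrow> real^2 \<Rightarrow> 'a^2" where
  "wave_op lam mu A w t x =
     pdt (pdt w) t x - mu *\<^sub>R laplacian (w t) x
       - (lam + mu) *\<^sub>R gradient (divergence (w t)) x + A_hess A w t x"

text \<open>\<^const>\<open>vector_derivative\<close> is total, so the existence of the partial derivatives occurring in
  the equation has to be required separately.\<close>

definition has_partials2 :: "(real \<Rightarrow> real^2 \<Rightarrow> 'a::real_normed_vector^2) \<Rightarrow> bool" where
  "has_partials2 w \<longleftrightarrow>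
     (\<forall>t x. (\<lambda>s. w s x) differentiable (at t) \<and> (\<lambda>s. pdt w s x) differentiable (at t)) \<and>
     (\<forall>t x m r. (\<lambda>s. w t (x + s *\<^sub>R axis r 1) $ m) differentiable (at 0)) \<and>
     (\<forall>t x m n r. (\<lambda>s. pdx r (\<lambda>y. w t y $ m) (x + s *\<^sub>R axis n 1)) differentiable (at 0))"

definition solves ::
  "real \<Rightarrow> real \<Rightarrow> (2 \<Rightarrow> 2 \<Rightarrow> 2 \<Rightarrow> 2 \<Rightarrow> real \<Rightarrow> real) \<Rightarrow> (real \<Rightarrow> real^2 \<Rightarrow> 'a::real_normed_vector^2)
    \<Rightarrow> (real \<Rightarrow> real^2 \<Rightarrow> 'a^2) \<Rightarrow> bool" where
  "solves lam mu A w g \<longleftrightarrow>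
     torus_fun w \<and> has_partials2 w \<and> (\<forall>t x. wave_op lam mu A w t x = g t x)"

definition vec_of_int :: "int^2 \<Rightarrow> real^2" where
  "vec_of_int f = (\<chi> k. real_of_int (f $ k))"

definition perp :: "real^2 \<Rightarrow> real^2" where
  "perp v = vector [- (v $ 2), v $ 1]"

definition xi :: "nat \<Rightarrow> real^2 \<Rightarrow> (real \<Rightarrow> real) \<Rightarrow> real \<Rightarrow> real^2 \<Rightarrow> real" where
  "xi lt f c t x = real lt * (f \<bullet> x - c t)"

definition w_wave ::
  "nat \<Rightarrow> real^2 \<Rightarrow> (real \<Rightarrow> real) \<Rightarrow> (real \<Rightarrow> real) \<Rightarrow> real \<Rightarrow> real^2 \<Rightarrow> complex^2" where
  "w_wave lt f a c t x =
     (\<chi> k. complex_of_real ((f + a t *\<^sub>R perp f) $ k) * exp (\<i> * complex_of_real (xi lt f c t x)))"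

definition w_error ::
  "nat \<Rightarrow> real^2 \<Rightarrow> (real \<Rightarrow> real) \<Rightarrow> (real \<Rightarrow> real) \<Rightarrow> real \<Rightarrow> real^2 \<Rightarrow> complex^2" where
  "w_error lt f a c t x =
     (\<chi> k. (- \<i> * of_nat lt * of_real ((deriv ^^ 2) c t) * of_real (f $ k)
            + (of_real ((deriv ^^ 2) a t)
               - \<i> * of_nat lt * of_real ((deriv ^^ 2) c t) * of_real (a t)
               - 2 * \<i> * of_nat lt * of_real (deriv c t) * of_real (deriv a t))
              * of_real (perp f $ k))
           * exp (\<i> * complex_of_real (xi lt f c t x)))"

definition cnj_vec :: "complex^2 \<Rightarrow> complex^2" where
  "cnj_vec z = (\<chi> k. cnj (z $ k))"

definition Re_vec :: "complex^2 \<Rightarrow> real^2" where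
  "Re_vec z = (\<chi> k. Re (z $ k))"

definition cvec :: "real^2 \<Rightarrow> complex^2" where
  "cvec v = (\<chi> k. complex_of_real (v $ k))"

end

theory Submission
  imports Defs
begin

text \<open>With \<open>e = f / |f|\<close> and \<open>c' = |f| sqrt s\<close>, the terms of order \<open>lt\<^sup>2\<close> cancel iff
  \<open>s (e + a e\<^sup>\<bottom>) = mu (e + a e\<^sup>\<bottom>) + (lam + mu) e - M (e + a e\<^sup>\<bottom>)\<close>, where
  \<open>M\<close> is the matrix \<open>\<Sum>n r. A k m n r e\<^sub>n e\<^sub>r\<close>. Its component along \<open>e\<close> gives
  \<open>s = lam + 2 mu - m11 - m12 a\<close>, and then the component along \<open>e\<^sup>\<bottom>\<close> becomes the quadratic equation
  \<open>m12 a\<^sup>2 - (lam + mu + m22 - m11) a - m21 = 0\<close>. Since \<open>lam + mu \<noteq> 0\<close>, for small \<open>A\<close> it has a root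
  of size \<open>m21\<close> that is an explicit algebraic function of the entries of \<open>A\<close>. Hence the derivatives of \<open>a\<close>
  and \<open>s\<close> inherit the bounds on those of \<open>A\<close>, because \<open>A0 \<le> 1\<close> makes these bounds stable under products.\<close>

section \<open>Functions of class \<open>C\<^sup>N\<close>\<close>

lemma CN_fun_0: "CN_fun 0 g \<longleftrightarrow> continuous_on UNIV g"
  by (simp add: CN_fun_def)

text \<open>The innermost derivative is split off, so that inductions on \<open>L\<close> can pass
  from \<open>g\<close> to \<open>deriv g\<close>.\<close>

lemma CN_fun_Suc: "CN_fun (Suc L) g \<longleftrightarrow> g differentiable_on UNIV \<and> CN_fun L (deriv g)"
proof -
  have "(\<forall>i<Suc L. (deriv ^^ i) g differentiable_on UNIV) \<longleftrightarrow>
      g differentiable_on UNIV \<and> (\<forall>i<L. (deriv ^^ i) (deriv g) differentiable_on UNIV)"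
    unfolding less_Suc_eq_0_disj by (auto simp: funpow_Suc_right simp del: funpow.simps(2))
  then show ?thesis
    unfolding CN_fun_def by (auto simp: funpow_Suc_right simp del: funpow.simps(2))
qed

lemma CN_fun_continuous: "CN_fun L g \<Longrightarrow> continuous_on UNIV g"
  by (cases L) (auto simp: CN_fun_0 CN_fun_Suc differentiable_imp_continuous_on)

lemma CN_fun_lower: "CN_fun (Suc L) g \<Longrightarrow> CN_fun L g"
  by (induction L arbitrary: g)
     (auto simp: CN_fun_Suc CN_fun_0 differentiable_imp_continuous_on)

lemma differentiable_on_UNIV_deriv:
  fixes g :: "real \<Rightarrow> real"
  assumes "g differentiable_on UNIV"
  shows "(g has_real_derivative deriv g t) (at t)"
proof -
  have "g differentiable (at t)"
    using assms by (auto simp: differentiable_on_def)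
  then show ?thesis
    by (simp add: DERIV_deriv_iff_real_differentiable)
qed

lemma differentiable_on_UNIV_I:
  fixes g :: "real \<Rightarrow> real"
  assumes "\<And>t. (g has_real_derivative g' t) (at t)"
  shows "g differentiable_on UNIV" "deriv g = g'"
  using assms
  by (auto simp: differentiable_on_def real_differentiable_def intro!: ext DERIV_imp_deriv)

lemma CN_norm_leD:
  assumes "CN_norm N g \<le> ereal B" "i \<le> N"
  shows "\<bar>(deriv ^^ i) g t\<bar> \<le> B"
proof -
  let ?S = "\<lambda>i. SUP t. ereal \<bar>(deriv ^^ i) g t\<bar>"
  have S: "0 \<le> ?S i" for i
    by (rule SUP_upper2[of 0]) auto
  have "ereal \<bar>(deriv ^^ i) g t\<bar> \<le> ?S i"
    by (rule SUP_upper) simp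
  also have "\<dots> \<le> (\<Sum>i\<le>N. ?S i)"
    using assms(2) S sum_mono2[of "{..N}" "{i}" ?S] by simp
  also have "\<dots> \<le> ereal B"
    using assms(1) by (simp add: CN_norm_def)
  finally show ?thesis by simp
qed

text \<open>The norm adds up N + 1 suprema, whence the factor \<open>Suc N\<close>; it is the source
  of \<open>real L + 1\<close> in the final constant.\<close>

lemma CN_norm_leI:
  assumes "\<And>i t. i \<le> N \<Longrightarrow> \<bar>(deriv ^^ i) g t\<bar> \<le> B"
  shows "CN_norm N g \<le> ereal (real (Suc N) * B)"
proof -
  have "CN_norm N g \<le> (\<Sum>i\<le>N. ereal B)"
    unfolding CN_norm_def by (intro sum_mono SUP_least) (simp add: assms)
  also have "\<dots> = ereal (real (Suc N) * B)"
    by simp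
  finally show ?thesis .
qed

lemma CN_norm_0_leI:
  assumes "\<And>t. \<bar>g t\<bar> \<le> B"
  shows "CN_norm 0 g \<le> ereal B"
  using CN_norm_leI[of 0 g B] assms by simp

section \<open>Families with uniformly bounded derivatives\<close>

text \<open>The bound \<open>R\<close> is shared by the whole family: this encodes constants that depend only on the listed
  quantities.\<close>

definition unif_bounded ::
  "'i set \<Rightarrow> ('i \<Rightarrow> nat \<Rightarrow> real) \<Rightarrow> nat \<Rightarrow> ('i \<Rightarrow> real \<Rightarrow> real) \<Rightarrow> bool" where
  "unif_bounded I W L G \<longleftrightarrow> (\<forall>i\<in>I. CN_fun L (G i)) \<and>
     (\<exists>R. \<forall>i\<in>I. \<forall>j\<le>L. \<forall>t. \<bar>(deriv ^^ j) (G i) t\<bar> \<le> R * W i j)"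

lemma unif_bounded_0:
  "unif_bounded I W 0 G \<longleftrightarrow> (\<forall>i\<in>I. continuous_on UNIV (G i)) \<and>
     (\<exists>R. \<forall>i\<in>I. \<forall>t. \<bar>G i t\<bar> \<le> R * W i 0)"
  by (simp add: unif_bounded_def CN_fun_0)

text \<open>Differentiation shifts the weight by one index, which drives the inductions below. The
  constants for order zero and for the derivatives merge into their maximum because the weights are
  nonnegative.\<close>

lemma unif_bounded_Suc:
  assumes W: "\<forall>i\<in>I. \<forall>j. 0 \<le> W i j"
  shows "unif_bounded I W (Suc L) G \<longleftrightarrow> (\<forall>i\<in>I. G i differentiable_on UNIV) \<and>
     (\<exists>R. \<forall>i\<in>I. \<forall>t. \<bar>G i t\<bar> \<le> R * W i 0) \<and>
     unif_bounded I (\<lambda>i j. W i (Suc j)) L (\<lambda>i. deriv (G i))"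
proof -
  let ?P = "\<lambda>R. \<forall>i\<in>I. \<forall>t. \<bar>G i t\<bar> \<le> R * W i 0"
  let ?Q = "\<lambda>R. \<forall>i\<in>I. \<forall>j\<le>L. \<forall>t. \<bar>(deriv ^^ j) (deriv (G i)) t\<bar> \<le> R * W i (Suc j)"
  have split: "(\<forall>i\<in>I. \<forall>j\<le>Suc L. \<forall>t. \<bar>(deriv ^^ j) (G i) t\<bar> \<le> R * W i j) \<longleftrightarrow> ?P R \<and> ?Q R" for R
  proof -
    have "(\<forall>j\<le>Suc L. Z j) \<longleftrightarrow> Z 0 \<and> (\<forall>j\<le>L. Z (Suc j))" for Z
      by (metis le0 not0_implies_Suc Suc_le_mono)
    then show ?thesis
      by (simp add: funpow_Suc_right del: funpow.simps(2)) blast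
  qed
  have "(\<exists>R. ?P R \<and> ?Q R) \<longleftrightarrow> (\<exists>R. ?P R) \<and> (\<exists>R. ?Q R)"
  proof safe
    fix R S assume *: "?P R" "?Q S"
    have "?P (max R S)" "?Q (max R S)"
      using * W by (meson max.cobounded1 max.cobounded2 mult_right_mono order_trans)+
    then show "\<exists>R. ?P R \<and> ?Q R" by blast
  qed blast+
  then show ?thesis
    unfolding unif_bounded_def split CN_fun_Suc by blast
qed

lemma unif_bounded_cong:
  assumes "\<And>i. i \<in> I \<Longrightarrow> G i = H i"
  shows "unif_bounded I W L G \<longleftrightarrow> unif_bounded I W L H"
  using assms by (simp add: unif_bounded_def cong: ball_cong)

text \<open>The induction step in usable form: \<open>G'\<close> may be whatever expression the
  rules of calculus produce.\<close>

lemma unif_bounded_SucI: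
  assumes "\<forall>i\<in>I. \<forall>j. 0 \<le> W i j"
    and "\<And>i t. i \<in> I \<Longrightarrow> (G i has_real_derivative G' i t) (at t)"
    and "\<exists>R. \<forall>i\<in>I. \<forall>t. \<bar>G i t\<bar> \<le> R * W i 0"
    and "unif_bounded I (\<lambda>i j. W i (Suc j)) L G'"
  shows "unif_bounded I W (Suc L) G"
proof -
  have *: "G i differentiable_on UNIV" "deriv (G i) = G' i" if "i \<in> I" for i
    using differentiable_on_UNIV_I[of "G i" "G' i"] assms(2)[OF that] by auto
  have "unif_bounded I (\<lambda>i j. W i (Suc j)) L (\<lambda>i. deriv (G i))"
    using assms(4) * unif_bounded_cong[of I "\<lambda>i. deriv (G i)" G'] by simp
  then show ?thesis
    using assms(3) * by (simp add: unif_bounded_Suc[OF assms(1)])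
qed

lemma unif_bounded_lower:
  "unif_bounded I W (Suc L) G \<Longrightarrow> unif_bounded I W L G"
  unfolding unif_bounded_def by (meson CN_fun_lower le_SucI)

lemma unif_bounded_bounded:
  assumes "unif_bounded I W L G" "\<forall>i\<in>I. W i 0 = 1"
  obtains R where "R > 0" "\<And>i t. i \<in> I \<Longrightarrow> \<bar>G i t\<bar> \<le> R"
proof -
  obtain R where "\<forall>i\<in>I. \<forall>j\<le>L. \<forall>t. \<bar>(deriv ^^ j) (G i) t\<bar> \<le> R * W i j"
    using assms(1) by (auto simp: unif_bounded_def)
  then have "\<bar>G i t\<bar> \<le> max R 1" if "i \<in> I" for i t
    using that assms(2) by (metis bot_nat_0.extremum funpow_0 le_max_iff_disj mult.right_neutral)
  then show thesis using that[of "max R 1"] by auto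
qed

lemma unif_bounded_add:
  fixes I :: "'i set"
  assumes "\<forall>i\<in>I. \<forall>j. 0 \<le> W i j" "unif_bounded I W L G" "unif_bounded I W L H"
  shows "unif_bounded I W L (\<lambda>i t. G i t + H i t)"
proof -
  have zero: "\<exists>R. \<forall>i\<in>I. \<forall>t. \<bar>G i t + H i t\<bar> \<le> R * W i 0"
    if G: "\<exists>R. \<forall>i\<in>I. \<forall>t. \<bar>G i t\<bar> \<le> R * W i 0" and H: "\<exists>R. \<forall>i\<in>I. \<forall>t. \<bar>H i t\<bar> \<le> R * W i 0"
    for G H :: "'i \<Rightarrow> real \<Rightarrow> real" and W :: "'i \<Rightarrow> nat \<Rightarrow> real"
  proof -
    obtain R S where R: "\<And>i t. i \<in> I \<Longrightarrow> \<bar>G i t\<bar> \<le> R * W i 0"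
      and S: "\<And>i t. i \<in> I \<Longrightarrow> \<bar>H i t\<bar> \<le> S * W i 0" using G H by blast
    have "\<bar>G i t + H i t\<bar> \<le> (R + S) * W i 0" if "i \<in> I" for i t
      using R[OF that, of t] S[OF that, of t] abs_triangle_ineq[of "G i t" "H i t"]
      unfolding distrib_right by linarith
    then show ?thesis by blast
  qed
  show ?thesis using assms
  proof (induction L arbitrary: W G H)
    case 0
    then show ?case
      by (auto simp: unif_bounded_0 intro!: zero continuous_intros)
  next
    case (Suc L)
    let ?W = "\<lambda>i j. W i (Suc j)"
    note G = Suc.prems(2)[unfolded unif_bounded_Suc[OF Suc.prems(1)]]
    note H = Suc.prems(3)[unfolded unif_bounded_Suc[OF Suc.prems(1)]]
    have D: "((\<lambda>t. G i t + H i t) has_real_derivative deriv (G i) t + deriv (H i) t) (at t)"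
      if "i \<in> I" for i t
      using G H that by (intro DERIV_add differentiable_on_UNIV_deriv) auto
    have "unif_bounded I ?W L (\<lambda>i t. deriv (G i) t + deriv (H i) t)"
      using G H Suc.prems(1) by (intro Suc.IH) auto
    moreover have "\<exists>R. \<forall>i\<in>I. \<forall>t. \<bar>G i t + H i t\<bar> \<le> R * W i 0"
      using G H by (intro zero) (elim conjE; assumption)+
    ultimately show ?case
      by (intro unif_bounded_SucI[OF Suc.prems(1) D])
  qed
qed

text \<open>Three separate weights make the induction work: the Leibniz rule differentiates one
  factor at a time, and the inequality between \<open>U\<close>, \<open>V\<close> and
  \<open>W\<close> survives a shift of \<open>U\<close> and \<open>W\<close>, or of \<open>V\<close>
  and \<open>W\<close>.\<close>

lemma unif_bounded_mult:
  fixes I :: "'i set"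
  assumes "\<forall>i\<in>I. \<forall>j. 0 \<le> U i j" "\<forall>i\<in>I. \<forall>j. 0 \<le> V i j"
    and "\<forall>i\<in>I. \<forall>j k. U i j * V i k \<le> W i (j + k)"
    and "unif_bounded I U L G" "unif_bounded I V L H"
  shows "unif_bounded I W L (\<lambda>i t. G i t * H i t)"
proof -
  have zero: "\<exists>R. \<forall>i\<in>I. \<forall>t. \<bar>G i t * H i t\<bar> \<le> R * W i 0"
    if U: "\<forall>i\<in>I. \<forall>j. 0 \<le> U i j" and V: "\<forall>i\<in>I. \<forall>j. 0 \<le> V i j"
    and UVW: "\<forall>i\<in>I. \<forall>j k. U i j * V i k \<le> W i (j + k)"
    and G: "\<exists>R. \<forall>i\<in>I. \<forall>t. \<bar>G i t\<bar> \<le> R * U i 0" and H: "\<exists>R. \<forall>i\<in>I. \<forall>t. \<bar>H i t\<bar> \<le> R * V i 0"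
    for G H :: "'i \<Rightarrow> real \<Rightarrow> real" and U V W :: "'i \<Rightarrow> nat \<Rightarrow> real"
  proof -
    obtain R S where R: "\<And>i t. i \<in> I \<Longrightarrow> \<bar>G i t\<bar> \<le> R * U i 0"
      and S: "\<And>i t. i \<in> I \<Longrightarrow> \<bar>H i t\<bar> \<le> S * V i 0" using G H by blast
    \<comment> \<open>Nothing forces \<open>R\<close> and \<open>S\<close> to be nonnegative, hence
      the absolute values.\<close>
    have "\<bar>G i t * H i t\<bar> \<le> (\<bar>R\<bar> * \<bar>S\<bar>) * W i 0" if i: "i \<in> I" for i t
    proof -
      have "\<bar>G i t\<bar> \<le> \<bar>R\<bar> * U i 0" "\<bar>H i t\<bar> \<le> \<bar>S\<bar> * V i 0"
        using R[OF i, of t] S[OF i, of t] mult_right_mono[OF abs_ge_self[of R] U[rule_format, OF i, of 0]]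
          mult_right_mono[OF abs_ge_self[of S] V[rule_format, OF i, of 0]] by linarith+
      then have "\<bar>G i t * H i t\<bar> \<le> (\<bar>R\<bar> * U i 0) * (\<bar>S\<bar> * V i 0)"
        unfolding abs_mult by (rule mult_mono') auto
      also have "\<dots> = (\<bar>R\<bar> * \<bar>S\<bar>) * (U i 0 * V i 0)" by simp
      also have "\<dots> \<le> (\<bar>R\<bar> * \<bar>S\<bar>) * W i 0"
        using UVW[rule_format, OF i, of 0 0] by (intro mult_left_mono) auto
      finally show ?thesis .
    qed
    then show ?thesis by blast
  qed
  show ?thesis using assms
  proof (induction L arbitrary: U V W G H)
    case 0
    then show ?case
      by (auto simp: unif_bounded_0 intro!: zero[of U V W G H] continuous_intros)
  next
    case (Suc L)
    note U = Suc.prems(1) and V = Suc.prems(2) and UVW = Suc.prems(3)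
    have W: "\<forall>i\<in>I. \<forall>j. 0 \<le> W i j"
    proof (intro ballI allI)
      fix i j assume i: "i \<in> I"
      have "0 \<le> U i 0 * V i j" using U V i by simp
      also have "\<dots> \<le> W i (0 + j)" using UVW i by blast
      finally show "0 \<le> W i j" by simp
    qed
    let ?U = "\<lambda>i j. U i (Suc j)" and ?V = "\<lambda>i j. V i (Suc j)" and ?W = "\<lambda>i j. W i (Suc j)"
    note G = Suc.prems(4)[unfolded unif_bounded_Suc[OF U]]
    note H = Suc.prems(5)[unfolded unif_bounded_Suc[OF V]]
    have D: "((\<lambda>t. G i t * H i t) has_real_derivative deriv (G i) t * H i t + G i t * deriv (H i) t) (at t)"
      if "i \<in> I" for i t
      using DERIV_mult[OF differentiable_on_UNIV_deriv[of "G i" t] differentiable_on_UNIV_deriv[of "H i" t]]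
        G H that by (simp add: algebra_simps)
    have UVW': "U i (Suc j) * V i k \<le> W i (Suc (j + k))" "U i j * V i (Suc k) \<le> W i (Suc (j + k))"
      if "i \<in> I" for i j k
      using UVW[rule_format, OF that, of "Suc j" k] UVW[rule_format, OF that, of j "Suc k"] by auto
    \<comment> \<open>In each summand the undifferentiated factor keeps its unshifted weight and is
      used with one order of regularity less.\<close>
    have "unif_bounded I ?W L (\<lambda>i t. deriv (G i) t * H i t + G i t * deriv (H i) t)"
    proof (intro unif_bounded_add)
      show "unif_bounded I ?W L (\<lambda>i t. deriv (G i) t * H i t)"
        using G unif_bounded_lower[OF Suc.prems(5)] U V UVW'
        by (intro Suc.IH[of ?U V]) auto
      show "unif_bounded I ?W L (\<lambda>i t. G i t * deriv (H i) t)"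
        using H unif_bounded_lower[OF Suc.prems(4)] U V UVW'
        by (intro Suc.IH[of U ?V]) auto
    qed (use W in auto)
    moreover have "\<exists>R. \<forall>i\<in>I. \<forall>t. \<bar>G i t * H i t\<bar> \<le> R * W i 0"
      using G H by (intro zero[OF U V UVW]) (elim conjE; assumption)+
    ultimately show ?case
      by (intro unif_bounded_SucI[OF W D])
  qed
qed

text \<open>All derivatives of positive order vanish, so the weight matters only at index zero and
  may even be zero afterwards.\<close>

lemma unif_bounded_const:
  assumes "\<forall>i\<in>I. \<forall>j. 0 \<le> W i j" "\<And>i. i \<in> I \<Longrightarrow> \<bar>g i\<bar> \<le> R * W i 0"
  shows "unif_bounded I W L (\<lambda>i t. g i)"
  using assms
proof (induction L arbitrary: W g R)
  case 0
  then show ?case by (auto simp: unif_bounded_0)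
next
  case (Suc L)
  have "unif_bounded I (\<lambda>i j. W i (Suc j)) L (\<lambda>i t. 0)"
    using Suc.prems(1) by (intro Suc.IH[of _ _ 0]) auto
  with Suc.prems show ?case by (subst unif_bounded_Suc) auto
qed

text \<open>The instance of interest is \<open>W i 0 = 1\<close>, \<open>W i j = A0 * lA ^ j\<close> for \<open>j > 0\<close>.\<close>

locale alg_weight =
  fixes I :: "'i set" and W :: "'i \<Rightarrow> nat \<Rightarrow> real"
  assumes nonneg: "\<forall>i\<in>I. \<forall>j. 0 \<le> W i j"
    and zero: "\<forall>i\<in>I. W i 0 = 1"
    and submult: "\<forall>i\<in>I. \<forall>j k. W i j * W i k \<le> W i (j + k)"
begin

lemma const: "(\<And>i. i \<in> I \<Longrightarrow> \<bar>g i\<bar> \<le> R) \<Longrightarrow> unif_bounded I W L (\<lambda>i t. g i)"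
  by (rule unif_bounded_const[of _ _ _ R]) (use nonneg zero in auto)

lemma const_fixed: "unif_bounded I W L (\<lambda>i t. r)"
  by (rule const[of _ "\<bar>r\<bar>"]) auto

lemma add:
  "unif_bounded I W L G \<Longrightarrow> unif_bounded I W L H \<Longrightarrow> unif_bounded I W L (\<lambda>i t. G i t + H i t)"
  by (rule unif_bounded_add) (rule nonneg)

lemma mult:
  "unif_bounded I W L G \<Longrightarrow> unif_bounded I W L H \<Longrightarrow> unif_bounded I W L (\<lambda>i t. G i t * H i t)"
  by (rule unif_bounded_mult[of _ W W]) (use nonneg submult in auto)

lemma diff:
  assumes "unif_bounded I W L G" "unif_bounded I W L H"
  shows "unif_bounded I W L (\<lambda>i t. G i t - H i t)"
  using add[OF assms(1) mult[OF const_fixed[of _ "-1"] assms(2)]] by simp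

lemma sum:
  "(\<And>k. k \<in> S \<Longrightarrow> unif_bounded I W L (G k)) \<Longrightarrow> unif_bounded I W L (\<lambda>i t. \<Sum>k\<in>S. G k i t)"
  by (induction S rule: infinite_finite_induct) (auto intro: const_fixed add)

text \<open>The derivative of \<open>G powr p\<close> is \<open>deriv G\<close> times a multiple of
  \<open>G powr (p - 1)\<close>, so the induction on \<open>L\<close> has to treat all exponents at
  once. The common lower bound \<delta> keeps negative powers uniformly bounded.\<close>

lemma powr:
  assumes "unif_bounded I W L G" "0 < \<delta>" "\<And>i t. i \<in> I \<Longrightarrow> \<delta> \<le> G i t"
  shows "unif_bounded I W L (\<lambda>i t. G i t powr p)"
proof -
  obtain R where "R > 0" and R: "\<And>i t. i \<in> I \<Longrightarrow> \<bar>G i t\<bar> \<le> R"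
    using unif_bounded_bounded[OF assms(1) zero] by blast
  have bound: "\<exists>R. \<forall>i\<in>I. \<forall>t. \<bar>G i t powr p\<bar> \<le> R * W i 0" for p
  proof (intro exI ballI allI)
    fix i t assume i: "i \<in> I"
    \<comment> \<open>The values lie between \<delta> and \<open>R\<close>; the sign of
      \<open>p\<close> decides at which end the power is largest.\<close>
    have "G i t powr p \<le> max (R powr p) (\<delta> powr p)"
    proof (cases "p \<ge> 0")
      case True
      then show ?thesis using assms(2) assms(3)[OF i, of t] R[OF i, of t]
        by (intro max.coboundedI1 powr_mono2) auto
    next
      case False
      then show ?thesis using assms(2) assms(3)[OF i, of t]
        by (intro max.coboundedI2 powr_mono2') auto
    qed
    then show "\<bar>G i t powr p\<bar> \<le> max (R powr p) (\<delta> powr p) * W i 0"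
      using zero i by simp
  qed
  have pos: "0 < G i t" if "i \<in> I" for i t
    using assms(2) assms(3)[OF that, of t] by simp
  show ?thesis using assms(1)
  proof (induction L arbitrary: p)
    case 0
    have "continuous_on UNIV (\<lambda>t. G i t powr p)" if "i \<in> I" for i
      using 0 that pos[OF that, THEN less_imp_neq, symmetric]
      by (intro continuous_on_powr continuous_on_const) (simp_all add: unif_bounded_0)
    then show ?case using bound by (auto simp: unif_bounded_0)
  next
    case (Suc L)
    let ?W = "\<lambda>i j. W i (Suc j)"
    note G = Suc.prems[unfolded unif_bounded_Suc[OF nonneg]]
    have D: "((\<lambda>t. G i t powr p) has_real_derivative deriv (G i) t * (p * G i t powr (p - 1))) (at t)"
      if "i \<in> I" for i t
      using DERIV_fun_powr[OF differentiable_on_UNIV_deriv[of "G i" t] pos[OF that], of p] G that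
      by (simp add: mult_ac)
    have "unif_bounded I W L (\<lambda>i t. p * G i t powr (p - 1))"
      by (intro mult const_fixed Suc.IH[OF unif_bounded_lower[OF Suc.prems]])
    moreover have "\<forall>i\<in>I. \<forall>j k. W i (Suc j) * W i k \<le> W i (Suc (j + k))"
      using submult by (metis add_Suc)
    ultimately have "unif_bounded I ?W L (\<lambda>i t. deriv (G i) t * (p * G i t powr (p - 1)))"
      using G nonneg by (intro unif_bounded_mult[of I ?W W ?W]) auto
    then show ?case
      by (intro unif_bounded_SucI[OF nonneg D bound])
  qed
qed

lemma sqrt:
  assumes "unif_bounded I W L G" "0 < \<delta>" "\<And>i t. i \<in> I \<Longrightarrow> \<delta> \<le> G i t"
  shows "unif_bounded I W L (\<lambda>i t. sqrt (G i t))"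
proof -
  have "0 \<le> G i t" if "i \<in> I" for i t
    using assms(2) assms(3)[OF that, of t] by simp
  then show ?thesis
    using powr[OF assms, of "1/2"] by (subst unif_bounded_cong) (auto simp: powr_half_sqrt)
qed

text \<open>\<open>G\<close> may be negative whereas \<open>powr\<close> is controlled for positive
  bases only; hence the reciprocal is written as \<open>G\<close> times the power -1 of its
  square.\<close>

lemma inverse:
  assumes "unif_bounded I W L G" "0 < \<delta>" "\<And>i t. i \<in> I \<Longrightarrow> \<delta> \<le> \<bar>G i t\<bar>"
  shows "unif_bounded I W L (\<lambda>i t. inverse (G i t))"
proof -
  have sq: "\<delta> * \<delta> \<le> G i t * G i t" if "i \<in> I" for i t
    using mult_mono[OF assms(3)[OF that, of t] assms(3)[OF that, of t]] assms(2) by simp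
  have "unif_bounded I W L (\<lambda>i t. G i t * (G i t * G i t) powr (- 1))"
    using assms(2) sq by (intro mult powr[of _ _ "\<delta> * \<delta>"] assms(1)) auto
  moreover have "inverse (G i t) = G i t * (G i t * G i t) powr (- 1)" if "i \<in> I" for i t
  proof -
    have "0 < G i t * G i t"
      using sq[OF that, of t] mult_pos_pos[OF assms(2) assms(2)] by linarith
    then show ?thesis by (auto simp: powr_minus divide_simps)
  qed
  ultimately show ?thesis
    by (subst unif_bounded_cong) auto
qed

end

section \<open>Plane waves and the wave operator\<close>

lemma bounded_linear_axis: "bounded_linear (axis k :: 'a::real_normed_vector \<Rightarrow> 'a^'n)"
proof (rule bounded_linear_intro[of _ 1])
  show "norm (axis k x :: 'a^'n) \<le> norm x * 1" for x
    by (simp add: norm_vec_def L2_set_def axis_def if_distrib[of norm] if_distrib[of "\<lambda>x. x\<^sup>2"] cong: if_cong)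
qed (auto simp: axis_def vec_eq_iff)

text \<open>A vector is the finite sum of its components placed on the axes by bounded linear
  maps.\<close>

lemma has_vector_derivative_vec:
  fixes f :: "'n::finite \<Rightarrow> real \<Rightarrow> 'a::real_normed_vector"
  assumes "\<And>k. (f k has_vector_derivative f' k) F"
  shows "((\<lambda>t. \<chi> k. f k t) has_vector_derivative (\<chi> k. f' k)) F"
proof -
  have *: "(\<chi> k. g k) = (\<Sum>k\<in>UNIV. axis k (g k))" for g :: "'n \<Rightarrow> 'a"
    by (simp add: vec_eq_iff axis_def if_distrib cong: if_cong)
  show ?thesis
    unfolding *
    by (intro has_vector_derivative_sum bounded_linear.has_vector_derivative[OF bounded_linear_axis] assms)
qed

text \<open>A bounded linear map acting on components commutes with all derivatives and with the
  real coefficients. The instances are conjugation and twice the real part; the latter changes the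
  value type.\<close>

lemma solves_bounded_linear:
  fixes w :: "real \<Rightarrow> real^2 \<Rightarrow> 'a::real_normed_vector^2" and T :: "'a \<Rightarrow> 'b::real_normed_vector"
  assumes "solves lam mu A w g" and T: "bounded_linear T"
  shows "solves lam mu A (\<lambda>t x. \<chi> k. T (w t x $ k)) (\<lambda>t x. \<chi> k. T (g t x $ k))"
proof -
  let ?T = "\<lambda>z::'a^2. \<chi> k. T (z $ k)"
  interpret T: bounded_linear T by fact
  have T': "bounded_linear ?T"
  proof -
    have *: "?T z = (\<Sum>k\<in>UNIV. axis k (T (z $ k)))" for z
      by (simp add: vec_eq_iff axis_def if_distrib cong: if_cong)
    show ?thesis
      unfolding *
      by (intro bounded_linear_sum bounded_linear_compose[OF bounded_linear_axis]
          bounded_linear_compose[OF T] bounded_linear_vec_nth)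
  qed
  interpret T': bounded_linear ?T by fact
  have torus: "torus_fun w" and partials: "has_partials2 w"
    and eq: "wave_op lam mu A w t x = g t x" for t x
    using assms(1) by (auto simp: solves_def)
  \<comment> \<open>\<open>has_partials2\<close> makes the total operators \<open>pdt\<close> and
    \<open>pdx\<close> genuine derivatives, through which \<open>T\<close> can be passed.\<close>
  have dt: "((\<lambda>s. w s x) has_vector_derivative pdt w t x) (at t)"
    "((\<lambda>s. pdt w s x) has_vector_derivative pdt (pdt w) t x) (at t)" for t x
    using partials by (auto simp: has_partials2_def pdt_def vector_derivative_works)
  have dx1: "((\<lambda>s. w t (x + s *\<^sub>R axis r 1) $ m) has_vector_derivative pdx r (\<lambda>y. w t y $ m) x) (at 0)"
    for t x m r
    unfolding pdx_def using partials by (simp add: has_partials2_def flip: vector_derivative_works)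
  have dx2: "((\<lambda>s. pdx r (\<lambda>y. w t y $ m) (x + s *\<^sub>R axis n 1)) has_vector_derivative
      pdx n (pdx r (\<lambda>y. w t y $ m)) x) (at 0)" for t x m n r
    unfolding pdx_def[of n "pdx r (\<lambda>y. w t y $ m)"]
    using partials by (simp add: has_partials2_def flip: vector_derivative_works)
  have Dt: "((\<lambda>s. ?T (w s x)) has_vector_derivative ?T (pdt w t x)) (at t)"
    "((\<lambda>s. ?T (pdt w s x)) has_vector_derivative ?T (pdt (pdt w) t x)) (at t)" for t x
    by (intro T'.has_vector_derivative dt)+
  have Dx: "((\<lambda>s. T (w t (x + s *\<^sub>R axis r 1) $ m)) has_vector_derivative T (pdx r (\<lambda>y. w t y $ m) x)) (at 0)"
    "((\<lambda>s. T (pdx r (\<lambda>y. w t y $ m) (x + s *\<^sub>R axis n 1))) has_vector_derivative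
      T (pdx n (pdx r (\<lambda>y. w t y $ m)) x)) (at 0)" for t x m n r
    by (intro T.has_vector_derivative dx1 dx2)+
  have pdt1: "pdt (\<lambda>t x. ?T (w t x)) = (\<lambda>t x. ?T (pdt w t x))"
    unfolding pdt_def[of "\<lambda>t x. ?T (w t x)"] by (intro ext vector_derivative_at Dt)
  have pdt2: "pdt (\<lambda>t x. ?T (pdt w t x)) = (\<lambda>t x. ?T (pdt (pdt w) t x))"
    unfolding pdt_def[of "\<lambda>t x. ?T (pdt w t x)"] by (intro ext vector_derivative_at Dt)
  have pdx1: "pdx r (\<lambda>y. T (w t y $ m)) = (\<lambda>x. T (pdx r (\<lambda>y. w t y $ m) x))" for t r m
    unfolding pdx_def[of r "\<lambda>y. T (w t y $ m)"] by (intro ext vector_derivative_at Dx)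
  have pdx2: "pdx n (\<lambda>y. T (pdx r (\<lambda>y. w t y $ m) y)) = (\<lambda>x. T (pdx n (pdx r (\<lambda>y. w t y $ m)) x))" for t r m n
    unfolding pdx_def[of n "\<lambda>y. T (pdx r (\<lambda>y. w t y $ m) y)"] by (intro ext vector_derivative_at Dx)
  \<comment> \<open>The divergence is a sum of first partials, so its own partials are sums of the
    second partials known to exist.\<close>
  have div: "pdx k (divergence (w t)) x = (\<Sum>m\<in>UNIV. pdx k (pdx m (\<lambda>y. w t y $ m)) x)" for k t x
    unfolding divergence_def pdx_def[of k "\<lambda>x. \<Sum>m\<in>UNIV. pdx m (\<lambda>y. w t y $ m) x"]
    by (intro vector_derivative_at has_vector_derivative_sum dx2)
  have divT: "pdx k (divergence (\<lambda>x. ?T (w t x))) x = T (pdx k (divergence (w t)) x)" for k t x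
    unfolding div T.sum divergence_def pdx_def[of k "\<lambda>x. \<Sum>m\<in>UNIV. pdx m (\<lambda>y. ?T (w t y) $ m) x"]
    by (intro vector_derivative_at has_vector_derivative_sum) (simp add: pdx1 Dx)
  have "has_partials2 (\<lambda>t x. ?T (w t x))"
    unfolding has_partials2_def pdt1
    by (auto simp: pdx1 intro!: differentiableI_vector Dt Dx)
  moreover have "torus_fun (\<lambda>t x. ?T (w t x))"
    using torus by (simp add: torus_fun_def)
  moreover have "wave_op lam mu A (\<lambda>t x. ?T (w t x)) t x = ?T (g t x)" for t x
    unfolding eq[symmetric]
    by (simp add: vec_eq_iff wave_op_def laplacian_def gradient_def A_hess_def pdt1 pdt2 pdx1 pdx2 divT
        pdx2 T.add T.diff T.scaleR T.sum)
  ultimately show ?thesis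
    by (simp add: solves_def)
qed

text \<open>\<open>disp\<close> expresses the cancellation of the terms of order
  \<open>lt\<^sup>2\<close>, for \<open>F\<close> not normalised; what remains is
  \<open>w_error\<close>. Spatial derivatives only multiply by \<open>z r\<close>, while time
  derivatives also hit the amplitude.\<close>

lemma solves_w_wave:
  fixes a a' a'' c c' c'' :: "real \<Rightarrow> real" and f :: "int^2"
  defines "F \<equiv> vec_of_int f"
  assumes a: "\<And>t. (a has_real_derivative a' t) (at t)" "\<And>t. (a' has_real_derivative a'' t) (at t)"
    and c: "\<And>t. (c has_real_derivative c' t) (at t)" "\<And>t. (c' has_real_derivative c'' t) (at t)"
    and disp: "\<And>t k. (c' t)\<^sup>2 * (F + a t *\<^sub>R perp F) $ k =
      mu * (F \<bullet> F) * (F + a t *\<^sub>R perp F) $ k + (lam + mu) * (F \<bullet> F) * F $ k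
       - (\<Sum>m\<in>UNIV. \<Sum>n\<in>UNIV. \<Sum>r\<in>UNIV. A k m n r t * (F $ n * F $ r * (F + a t *\<^sub>R perp F) $ m))"
  shows "solves lam mu A (w_wave lt F a c) (w_error lt F a c)"
proof -
  let ?w = "w_wave lt F a c"
  let ?v = "\<lambda>t k. (F + a t *\<^sub>R perp F) $ k"
  let ?E = "\<lambda>t x. exp (\<i> * complex_of_real (xi lt F c t x))"
  define z where "z r = \<i> * of_real (real lt * F $ r)" for r
  have w: "?w t x $ k = of_real (?v t k) * ?E t x" for t x k
    by (simp add: w_wave_def)
  have torus: "torus_fun ?w"
    unfolding torus_fun_def
  proof (intro allI)
    fix t x j
    \<comment> \<open>Since \<open>lt\<close> and the entries of \<open>f\<close> are integers, the
      phase moves by an integer multiple of 2 \<pi>.\<close>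
    have "\<i> * complex_of_real (xi lt F c t (x + (2 * pi) *\<^sub>R axis j 1)) =
      \<i> * of_real (xi lt F c t x) + \<i> * (of_int (int lt * f $ j) * (of_real pi * 2))"
      by (simp add: xi_def F_def vec_of_int_def inner_add_right inner_axis algebra_simps)
    then have "?E t (x + (2 * pi) *\<^sub>R axis j 1) = ?E t x"
      by (simp only: exp_plus_2pin)
    then show "?w t (x + (2 * pi) *\<^sub>R axis j 1) = ?w t x"
      by (simp add: w_wave_def)
  qed
  have dE: "((\<lambda>s. ?E t (x + s *\<^sub>R axis r 1)) has_vector_derivative z r * ?E t x) (at 0)" for t x r
  proof -
    have "((\<lambda>s. xi lt F c t (x + s *\<^sub>R axis r 1)) has_real_derivative real lt * F $ r) (at 0)"
      unfolding xi_def inner_add_right inner_scaleR_right inner_axis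
      by (auto intro!: derivative_eq_intros)
    then have "((\<lambda>s. \<i> * complex_of_real (xi lt F c t (x + s *\<^sub>R axis r 1))) has_vector_derivative z r) (at 0)"
      unfolding z_def by (intro has_vector_derivative_mult_right has_vector_derivative_of_real)
    from field_vector_diff_chain_at[OF this DERIV_exp] show ?thesis
      by (simp add: o_def)
  qed
  have dtE: "((\<lambda>t. ?E t x) has_vector_derivative - \<i> * of_real (real lt * c' t) * ?E t x) (at t)" for t x
  proof -
    have "((\<lambda>t. xi lt F c t x) has_real_derivative - (real lt * c' t)) (at t)"
      unfolding xi_def by (auto intro!: derivative_eq_intros c)
    then have "((\<lambda>t. \<i> * complex_of_real (xi lt F c t x)) has_vector_derivative \<i> * of_real (- (real lt * c' t))) (at t)"
      by (intro has_vector_derivative_mult_right has_vector_derivative_of_real)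
    from field_vector_diff_chain_at[OF this DERIV_exp] show ?thesis
      by (simp add: o_def)
  qed
  have dx: "((\<lambda>s. p * ?w t (x + s *\<^sub>R axis r 1) $ m) has_vector_derivative z r * p * ?w t x $ m) (at 0)" for t x r m p
    unfolding w using has_vector_derivative_mult_right[OF dE[of t x r], of "p * of_real (?v t m)"]
    by (simp add: mult_ac)
  have pdx: "pdx r (\<lambda>y. p * ?w t y $ m) = (\<lambda>x. z r * p * ?w t x $ m)" for t r m p
    unfolding pdx_def by (intro ext vector_derivative_at dx)
  have pdx1: "pdx r (\<lambda>y. ?w t y $ m) = (\<lambda>x. z r * ?w t x $ m)" for t r m
    using pdx[of r 1 t m] by simp
  \<comment> \<open>\<open>u\<close> is the factor of the exponential in the first time derivative
    of the wave; \<open>u'\<close> will be the time derivative of \<open>u\<close>.\<close>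
  define u where "u t k = of_real (a' t * perp F $ k) - \<i> * of_real (real lt * c' t * ?v t k)" for t k
  define u' where "u' t k = of_real (a'' t * perp F $ k)
    - \<i> * of_real (real lt * (c'' t * ?v t k + c' t * (a' t * perp F $ k)))" for t k
  have v: "((\<lambda>t. ?v t k) has_real_derivative a' t * perp F $ k) (at t)" for t k
    by (auto intro!: derivative_eq_intros a)
  have dt1: "((\<lambda>t. ?w t x) has_vector_derivative (\<chi> k. u t k * ?E t x)) (at t)" for t x
    unfolding w_wave_def
  proof (intro has_vector_derivative_vec)
    fix k
    show "((\<lambda>t. of_real (?v t k) * ?E t x) has_vector_derivative u t k * ?E t x) (at t)"
      using has_vector_derivative_mult[OF has_vector_derivative_of_real[OF v[of k t]] dtE[of x t]]
      by (simp add: u_def algebra_simps)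
  qed
  have u: "((\<lambda>t. u t k) has_vector_derivative u' t k) (at t)" for t k
  proof -
    have "((\<lambda>t. a' t * perp F $ k) has_real_derivative a'' t * perp F $ k) (at t)"
      by (auto intro!: derivative_eq_intros a)
    moreover have "((\<lambda>t. real lt * c' t * ?v t k) has_real_derivative
        real lt * (c'' t * ?v t k + c' t * (a' t * perp F $ k))) (at t)"
      using DERIV_cmult[OF DERIV_mult[OF c(2)[of t] v[of k t]], of "real lt"] by (simp add: algebra_simps)
    ultimately show ?thesis
      unfolding u_def u'_def
      by (intro has_vector_derivative_diff has_vector_derivative_mult_right has_vector_derivative_of_real)
  qed
  have pdt1: "pdt ?w = (\<lambda>t x. \<chi> k. u t k * ?E t x)"
    unfolding pdt_def[of ?w] by (intro ext vector_derivative_at dt1)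
  have dt2: "((\<lambda>t. pdt ?w t x) has_vector_derivative
      (\<chi> k. (u' t k - \<i> * of_real (real lt * c' t) * u t k) * ?E t x)) (at t)" for t x
    unfolding pdt1
  proof (intro has_vector_derivative_vec)
    fix k
    show "((\<lambda>t. u t k * ?E t x) has_vector_derivative
        (u' t k - \<i> * of_real (real lt * c' t) * u t k) * ?E t x) (at t)"
      using has_vector_derivative_mult[OF u[of k t] dtE[of x t]] by (simp add: algebra_simps)
  qed
  have pdt2: "pdt (pdt ?w) t x = (\<chi> k. (u' t k - \<i> * of_real (real lt * c' t) * u t k) * ?E t x)" for t x
    unfolding pdt_def[of "pdt ?w"] by (intro vector_derivative_at dt2)
  have partials: "has_partials2 ?w"
    unfolding has_partials2_def pdx1
    using differentiableI_vector[OF dt1] differentiableI_vector[OF dt2]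
      differentiableI_vector[OF dx] differentiableI_vector[OF dx[of 1, simplified]]
    by blast
  \<comment> \<open>As \<open>perp F\<close> is orthogonal to \<open>F\<close>, the amplitude
    \<open>a\<close> drops out of the divergence.\<close>
  have div: "divergence (?w t) x = of_real (F \<bullet> F) * (\<i> * of_nat lt * ?E t x)" for t x
    unfolding divergence_def pdx1 by (simp add: w sum_2 z_def perp_def inner_vec_def algebra_simps)
  have grad: "pdx k (divergence (?w t)) x = z k * of_real (F \<bullet> F) * (\<i> * of_nat lt * ?E t x)" for k t x
    unfolding div pdx_def
    using has_vector_derivative_mult_right[OF dE[of t x k], of "of_real (F \<bullet> F) * (\<i> * of_nat lt)"]
    by (intro vector_derivative_at) (simp add: mult_ac)
  have cdisp: "of_real ((c' t)\<^sup>2 * ?v t k) = (of_real (mu * (F \<bullet> F) * ?v t k + (lam + mu) * (F \<bullet> F) * F $ k)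
      - (\<Sum>m\<in>UNIV. \<Sum>n\<in>UNIV. \<Sum>r\<in>UNIV. of_real (A k m n r t * (F $ n * F $ r * ?v t m))) :: complex)" for t k
    unfolding disp by (simp only: of_real_diff of_real_sum)
  have lap: "laplacian (?w t) x $ k = - of_real ((real lt)\<^sup>2 * (F \<bullet> F) * ?v t k) * ?E t x" for t x k
    unfolding laplacian_def pdx1 pdx by (simp add: sum_2 z_def inner_vec_def w algebra_simps power2_eq_square)
  have hess: "A_hess A ?w t x $ k = - of_real ((real lt)\<^sup>2) *
      (\<Sum>m\<in>UNIV. \<Sum>n\<in>UNIV. \<Sum>r\<in>UNIV. of_real (A k m n r t * (F $ n * F $ r * ?v t m))) * ?E t x" for t x k
    unfolding A_hess_def pdx1 pdx by (simp add: sum_distrib_left sum_distrib_right w z_def scaleR_conv_of_real[where 'a=complex]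
        power2_eq_square mult_ac)
  have "deriv c = c'" "(deriv ^^ 2) c = c''" "deriv a = a'" "(deriv ^^ 2) a = a''"
    using a c by (auto simp: numeral_2_eq_2 differentiable_on_UNIV_I(2)[OF a(1)] differentiable_on_UNIV_I(2)[OF a(2)]
        differentiable_on_UNIV_I(2)[OF c(1)] differentiable_on_UNIV_I(2)[OF c(2)])
  note derivs = this
  have "wave_op lam mu A ?w t x $ k = w_error lt F a c t x $ k" for t x k
  proof -
    define S where "S = (\<Sum>m\<in>UNIV. \<Sum>n\<in>UNIV. \<Sum>r\<in>UNIV.
      complex_of_real (A k m n r t * (F $ n * F $ r * ?v t m)))"
    \<comment> \<open>The dispersion relation is solved for the contribution of \<open>A\<close>,
      which then can be eliminated.\<close>
    have S: "S = of_real (mu * (F \<bullet> F) * ?v t k + (lam + mu) * (F \<bullet> F) * F $ k - (c' t)\<^sup>2 * ?v t k)"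
      using cdisp[of t k] unfolding S_def by (simp add: algebra_simps)
    have "wave_op lam mu A ?w t x $ k =
      ((u' t k - \<i> * of_real (real lt * c' t) * u t k)
       + of_real (mu * ((real lt)\<^sup>2 * (F \<bullet> F) * ?v t k))
       + of_real ((lam + mu) * ((real lt)\<^sup>2 * F $ k * (F \<bullet> F))) - of_real ((real lt)\<^sup>2) * S) * ?E t x"
      unfolding wave_op_def S_def
      by (simp add: gradient_def grad pdt2 lap hess z_def scaleR_conv_of_real[where 'a=complex] power2_eq_square algebra_simps)
    \<comment> \<open>Inserting \<open>S\<close> cancels the terms with \<open>mu\<close> and
      \<open>lam + mu\<close>, and its part with \<open>(c' t)\<^sup>2\<close> cancels the one of
      order \<open>lt\<^sup>2\<close> in the second time derivative.\<close>
    also have "\<dots> = w_error lt F a c t x $ k"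
      unfolding S w_error_def derivs u_def u'_def
      by (simp add: power2_eq_square algebra_simps)
    finally show ?thesis .
  qed
  then show ?thesis
    using torus partials by (simp add: solves_def vec_eq_iff)
qed

section \<open>Amplitude and speed\<close>

text \<open>The root of \<open>p a\<^sup>2 - d a - q\<close> that tends to 0 with \<open>q\<close>, in a form that also covers \<open>p = 0\<close>.\<close>

definition small_root :: "real \<Rightarrow> real \<Rightarrow> real \<Rightarrow> real" where
  "small_root p q d = - 2 * q / (d * (1 + sqrt (1 + 4 * p * q / d\<^sup>2)))"

text \<open>With \<open>S\<close> for the square root,
  \<open>4 * p * q = d\<^sup>2 * (S - 1) * (1 + S)\<close> turns the quadratic equation into a
  rational identity; the bound holds because \<open>1 + S\<close> is at least 1.\<close>

lemma small_root:
  assumes "d \<noteq> 0" "0 \<le> 1 + 4 * p * q / d\<^sup>2"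
  shows "p * (small_root p q d)\<^sup>2 - d * small_root p q d - q = 0"
    and "\<bar>small_root p q d\<bar> \<le> 2 * \<bar>q\<bar> / \<bar>d\<bar>"
proof -
  define S where "S = sqrt (1 + 4 * p * q / d\<^sup>2)"
  have S: "0 \<le> S" "S\<^sup>2 = 1 + 4 * p * q / d\<^sup>2"
    using assms(2) by (simp_all add: S_def)
  have pq: "4 * p * q = d\<^sup>2 * (S - 1) * (1 + S)"
    using S(2) assms(1) by (simp add: field_simps power2_eq_square)
  have "p * (small_root p q d)\<^sup>2 = (4 * p * q) * q / (d\<^sup>2 * (1 + S)\<^sup>2)"
    unfolding small_root_def S_def[symmetric] by (simp add: power2_eq_square mult_ac)
  also have "\<dots> = (S - 1) * q / (1 + S)"
    unfolding pq using S(1) assms(1) by (simp add: power2_eq_square divide_simps)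
  finally show "p * (small_root p q d)\<^sup>2 - d * small_root p q d - q = 0"
    using S(1) assms(1) by (simp add: small_root_def flip: S_def) (simp add: divide_simps, simp add: algebra_simps)
  have "\<bar>d\<bar> * 1 \<le> \<bar>d\<bar> * (1 + S)"
    using S(1) by (intro mult_left_mono) auto
  then show "\<bar>small_root p q d\<bar> \<le> 2 * \<bar>q\<bar> / \<bar>d\<bar>"
    using S(1) assms(1) unfolding small_root_def S_def[symmetric] abs_divide abs_mult
    by (intro frac_le) auto
qed

text \<open>The factor 40 yields the bound 1/10, since 4 / |\<kappa>| times |\<kappa>| / 40 is 1/10.
  It also leaves ample room for keeping \<open>d\<close> away from 0 and the radicand away from 0,
  uniformly in the data.\<close>

lemma small_root_perturbation:
  fixes \<kappa> :: real
  assumes "\<kappa> \<noteq> 0" "40 * \<eta> \<le> \<bar>\<kappa>\<bar>" "\<bar>m11\<bar> \<le> \<eta>" "\<bar>m12\<bar> \<le> \<eta>" "\<bar>m21\<bar> \<le> \<eta>" "\<bar>m22\<bar> \<le> \<eta>"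
  defines "d \<equiv> \<kappa> + m22 - m11"
  shows "\<bar>\<kappa>\<bar> / 2 \<le> \<bar>d\<bar>" "1 / 2 \<le> 1 + 4 * m12 * m21 / d\<^sup>2"
    and "m12 * (small_root m12 m21 d)\<^sup>2 - d * small_root m12 m21 d - m21 = 0"
    and "\<bar>small_root m12 m21 d\<bar> \<le> 4 / \<bar>\<kappa>\<bar> * \<bar>m21\<bar>" "\<bar>small_root m12 m21 d\<bar> \<le> 1 / 10"
proof -
  show d: "\<bar>\<kappa>\<bar> / 2 \<le> \<bar>d\<bar>"
    using assms(2-6) unfolding d_def by linarith
  have d0: "d \<noteq> 0"
    using d assms(1) by auto
  have "\<bar>m12\<bar> * \<bar>m21\<bar> \<le> (\<bar>\<kappa>\<bar> / 40) * (\<bar>\<kappa>\<bar> / 40)"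
    using assms by (intro mult_mono) auto
  moreover have "\<bar>\<kappa>\<bar> / 2 * (\<bar>\<kappa>\<bar> / 2) \<le> \<bar>d\<bar> * \<bar>d\<bar>"
    using d by (intro mult_mono) auto
  ultimately have "1600 * (\<bar>m12\<bar> * \<bar>m21\<bar>) \<le> 4 * d\<^sup>2"
    by (simp add: power2_eq_square)
  then have "8 * \<bar>m12 * m21\<bar> \<le> d\<^sup>2"
    unfolding abs_mult using zero_le_power2[of d] by linarith
  then have "- (d\<^sup>2) \<le> 8 * (m12 * m21)"
    by linarith
  then show h: "1 / 2 \<le> 1 + 4 * m12 * m21 / d\<^sup>2"
    using d0 by (simp add: field_simps)
  show "m12 * (small_root m12 m21 d)\<^sup>2 - d * small_root m12 m21 d - m21 = 0"
    using small_root(1)[OF d0] h by simp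
  have "\<bar>small_root m12 m21 d\<bar> \<le> 2 * \<bar>m21\<bar> / \<bar>d\<bar>"
    using small_root(2)[OF d0] h by simp
  also have "\<dots> \<le> 2 * \<bar>m21\<bar> / (\<bar>\<kappa>\<bar> / 2)"
    using d assms(1) by (intro divide_left_mono) auto
  finally show a: "\<bar>small_root m12 m21 d\<bar> \<le> 4 / \<bar>\<kappa>\<bar> * \<bar>m21\<bar>"
    by simp
  also have "\<dots> \<le> 4 / \<bar>\<kappa>\<bar> * (\<bar>\<kappa>\<bar> / 40)"
    using assms by (intro mult_left_mono) auto
  finally show "\<bar>small_root m12 m21 d\<bar> \<le> 1 / 10"
    using assms(1) by simp
qed

text \<open>This is the bilinear form \<open>u \<bullet> M v\<close> of the symbol matrix
  \<open>M\<close> in direction \<open>e\<close>; on the basis \<open>e\<close>,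
  \<open>perp e\<close> it gives the entries m11, m12, m21, m22.\<close>

definition symb ::
  "(2 \<Rightarrow> 2 \<Rightarrow> 2 \<Rightarrow> 2 \<Rightarrow> real \<Rightarrow> real) \<Rightarrow> real^2 \<Rightarrow> real^2 \<Rightarrow> real^2 \<Rightarrow> real \<Rightarrow> real" where
  "symb A e u v t = (\<Sum>k\<in>UNIV. \<Sum>m\<in>UNIV. \<Sum>n\<in>UNIV. \<Sum>r\<in>UNIV.
     u $ k * v $ m * e $ n * e $ r * A k m n r t)"

definition amp :: "real \<Rightarrow> (2 \<Rightarrow> 2 \<Rightarrow> 2 \<Rightarrow> 2 \<Rightarrow> real \<Rightarrow> real) \<Rightarrow> real^2 \<Rightarrow> real \<Rightarrow> real" where
  "amp \<kappa> A e t = small_root (symb A e e (perp e) t) (symb A e (perp e) e t)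
     (\<kappa> + symb A e (perp e) (perp e) t - symb A e e e t)"

text \<open>With \<kappa> standing for \<open>lam + mu\<close>, the unperturbed value \<kappa> + mu
  is \<open>lam + 2 * mu\<close>. The phase will have time derivative |f| times the square root of
  this.\<close>

definition speed2 :: "real \<Rightarrow> real \<Rightarrow> (2 \<Rightarrow> 2 \<Rightarrow> 2 \<Rightarrow> 2 \<Rightarrow> real \<Rightarrow> real) \<Rightarrow> real^2 \<Rightarrow> real \<Rightarrow> real" where
  "speed2 \<kappa> mu A e t = \<kappa> + mu - symb A e e e t - symb A e e (perp e) t * amp \<kappa> A e t"

lemma abs_mult_le_1: "\<bar>x\<bar> \<le> 1 \<Longrightarrow> \<bar>y\<bar> \<le> 1 \<Longrightarrow> \<bar>x * y\<bar> \<le> (1::real)"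
  by (simp add: abs_mult mult_le_one)

text \<open>The factor 16 counts the index quadruples.\<close>

lemma abs_symb_le:
  assumes "\<And>k m n r. \<bar>A k m n r t\<bar> \<le> B" "\<And>k. \<bar>e $ k\<bar> \<le> 1" "\<And>k. \<bar>u $ k\<bar> \<le> 1" "\<And>k. \<bar>v $ k\<bar> \<le> 1"
  shows "\<bar>symb A e u v t\<bar> \<le> 16 * B"
proof -
  have "\<bar>u $ k * v $ m * e $ n * e $ r * A k m n r t\<bar> \<le> 1 * B" for k m n r
    unfolding abs_mult[of _ "A k m n r t"]
    by (intro mult_mono assms abs_mult_le_1) auto
  then have "\<bar>symb A e u v t\<bar> \<le> (\<Sum>k\<in>(UNIV::2 set). \<Sum>m\<in>(UNIV::2 set). \<Sum>n\<in>(UNIV::2 set). \<Sum>r\<in>(UNIV::2 set). B)"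
    unfolding symb_def by (intro order_trans[OF sum_abs] sum_mono) simp
  then show ?thesis by simp
qed

lemma abs_perp_nth_le:
  assumes "\<And>k. \<bar>e $ k\<bar> \<le> 1"
  shows "\<bar>perp e $ k\<bar> \<le> 1"
  using assms exhaust_2[of k] by (auto simp: perp_def)

text \<open>Symbol entries are at most 16 B. This gives 64 = 4 * 16 for the amplitude, while the
  speed deviates by at most 16 B + 16 B / 10, rounded up to 32 B.\<close>

lemma amp_bounds:
  assumes \<kappa>: "\<kappa> \<noteq> 0" "40 * (16 * B) \<le> \<bar>\<kappa>\<bar>"
    and A: "\<And>k m n r. \<bar>A k m n r t\<bar> \<le> B" and e: "\<And>k. \<bar>e $ k\<bar> \<le> 1"
  shows "\<bar>amp \<kappa> A e t\<bar> \<le> 64 / \<bar>\<kappa>\<bar> * B" "\<bar>amp \<kappa> A e t\<bar> \<le> 1 / 10"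
    and "\<bar>speed2 \<kappa> mu A e t - (\<kappa> + mu)\<bar> \<le> 32 * B"
proof -
  note m = abs_symb_le[of A t B e, OF A e]
  note P = abs_perp_nth_le[OF e]
  note R = small_root_perturbation[OF \<kappa> m[OF e e] m[OF e P] m[OF P e] m[OF P P]]
  have "\<bar>amp \<kappa> A e t\<bar> \<le> 4 / \<bar>\<kappa>\<bar> * \<bar>symb A e (perp e) e t\<bar>"
    using R(4) by (simp add: amp_def)
  also have "\<dots> \<le> 4 / \<bar>\<kappa>\<bar> * (16 * B)"
    using m[OF P e] by (intro mult_left_mono) auto
  finally show "\<bar>amp \<kappa> A e t\<bar> \<le> 64 / \<bar>\<kappa>\<bar> * B" by simp
  show a: "\<bar>amp \<kappa> A e t\<bar> \<le> 1 / 10"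
    using R(5) by (simp add: amp_def)
  have "\<bar>symb A e e (perp e) t * amp \<kappa> A e t\<bar> \<le> 16 * B * (1 / 10)"
    unfolding abs_mult using m[OF e P] a by (intro mult_mono) auto
  then show "\<bar>speed2 \<kappa> mu A e t - (\<kappa> + mu)\<bar> \<le> 32 * B"
    using m[OF e e] unfolding speed2_def by linarith
qed

lemma (in alg_weight) unif_bounded_symb:
  assumes "\<And>k m n r. unif_bounded I W L (\<lambda>i. A i k m n r)"
    and "\<forall>i\<in>I. \<forall>k. \<bar>e i $ k\<bar> \<le> 1" "\<forall>i\<in>I. \<forall>k. \<bar>u i $ k\<bar> \<le> 1" "\<forall>i\<in>I. \<forall>k. \<bar>v i $ k\<bar> \<le> 1"
  shows "unif_bounded I W L (\<lambda>i. symb (A i) (e i) (u i) (v i))"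
proof -
  have "unif_bounded I W L (\<lambda>i t. symb (A i) (e i) (u i) (v i) t)"
    unfolding symb_def
    by (intro sum mult[of _ "\<lambda>i t. u i $ _ * v i $ _ * e i $ _ * e i $ _"] const[of _ 1] assms(1)
        abs_mult_le_1 assms(2-4)[rule_format])
  then show ?thesis .
qed

text \<open>Amplitude and speed are built from the coefficients by sums, products, reciprocals and
  square roots. Smallness of \<open>B\<close> provides the lower bounds for denominators and
  radicands that are uniform over the family.\<close>

lemma (in alg_weight) unif_bounded_amp:
  assumes A: "\<And>k m n r. unif_bounded I W L (\<lambda>i. A i k m n r)"
    and e: "\<forall>i\<in>I. \<forall>k. \<bar>e i $ k\<bar> \<le> 1"
    and B: "\<And>i k m n r t. i \<in> I \<Longrightarrow> \<bar>A i k m n r t\<bar> \<le> B"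
    and \<kappa>: "\<kappa> \<noteq> 0" "40 * (16 * B) \<le> \<bar>\<kappa>\<bar>"
  shows "unif_bounded I W L (\<lambda>i. amp \<kappa> (A i) (e i))"
    and "0 < \<kappa> + mu \<Longrightarrow> 64 * B \<le> \<kappa> + mu \<Longrightarrow> unif_bounded I W L (\<lambda>i t. sqrt (speed2 \<kappa> mu (A i) (e i) t))"
proof -
  let ?p = "\<lambda>i. perp (e i)"
  have P: "\<forall>i\<in>I. \<forall>k. \<bar>?p i $ k\<bar> \<le> 1"
    using abs_perp_nth_le e by blast
  note U = unif_bounded_symb[OF A, of e]
  note u11 = U[OF e e e] and u12 = U[OF e e P] and u21 = U[OF e P e] and u22 = U[OF e P P]
  let ?d = "\<lambda>i t. \<kappa> + symb (A i) (e i) (?p i) (?p i) t - symb (A i) (e i) (e i) (e i) t"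
  let ?h = "\<lambda>i t. 1 + 4 * symb (A i) (e i) (e i) (?p i) t * symb (A i) (e i) (?p i) (e i) t * (inverse (?d i t) * inverse (?d i t))"
  have h_eq: "x * (inverse d * inverse d) = x / d\<^sup>2" for x d :: real
    by (simp add: divide_inverse power2_eq_square)
  have pert: "\<bar>\<kappa>\<bar> / 2 \<le> \<bar>?d i t\<bar>" "1 / 2 \<le> ?h i t" if i: "i \<in> I" for i t
  proof -
    have e': "\<bar>e i $ k\<bar> \<le> 1" and P': "\<bar>?p i $ k\<bar> \<le> 1" for k
      using e P i by auto
    note m = abs_symb_le[of "A i" t B "e i", OF B[OF i] e']
    note R = small_root_perturbation[OF \<kappa> m[OF e' e'] m[OF e' P'] m[OF P' e'] m[OF P' P']]
    show "\<bar>\<kappa>\<bar> / 2 \<le> \<bar>?d i t\<bar>" by (rule R(1))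
    show "1 / 2 \<le> ?h i t" unfolding h_eq by (rule R(2))
  qed
  have d: "unif_bounded I W L ?d"
    by (intro diff add const_fixed u11 u22)
  have id: "unif_bounded I W L (\<lambda>i t. inverse (?d i t))"
    using \<kappa> pert by (intro inverse[OF d, of "\<bar>\<kappa>\<bar> / 2"]) auto
  have h: "unif_bounded I W L ?h"
    by (intro add mult const_fixed u12 u21 id)
  have s: "unif_bounded I W L (\<lambda>i t. 1 + sqrt (?h i t))"
    using pert by (intro add const_fixed sqrt[OF h, of "1 / 2"]) auto
  have i_s: "unif_bounded I W L (\<lambda>i t. inverse (1 + sqrt (?h i t)))"
  proof (rule inverse[OF s, of 1])
    show "1 \<le> \<bar>1 + sqrt (?h i t)\<bar>" if "i \<in> I" for i t
      using pert(2)[OF that, of t] real_sqrt_ge_zero[of "?h i t"] by linarith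
  qed simp
  have "unif_bounded I W L (\<lambda>i t. - 2 * symb (A i) (e i) (?p i) (e i) t * (inverse (?d i t) * inverse (1 + sqrt (?h i t))))"
    by (intro mult const_fixed u21 id i_s)
  also have "(\<lambda>i t. - 2 * symb (A i) (e i) (?p i) (e i) t * (inverse (?d i t) * inverse (1 + sqrt (?h i t)))) =
      (\<lambda>i. amp \<kappa> (A i) (e i))"
    unfolding amp_def small_root_def h_eq by (intro ext) (simp add: divide_inverse mult.assoc)
  finally show a: "unif_bounded I W L (\<lambda>i. amp \<kappa> (A i) (e i))" .
  have sp: "unif_bounded I W L (\<lambda>i t. speed2 \<kappa> mu (A i) (e i) t)"
    unfolding speed2_def by (intro diff mult const_fixed u11 u12 a)
  show "unif_bounded I W L (\<lambda>i t. sqrt (speed2 \<kappa> mu (A i) (e i) t))"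
    if "0 < \<kappa> + mu" "64 * B \<le> \<kappa> + mu"
  proof (rule sqrt[OF sp, of "(\<kappa> + mu) / 2"])
    \<comment> \<open>The deviation 32 B is at most half of \<kappa> + mu.\<close>
    show "(\<kappa> + mu) / 2 \<le> speed2 \<kappa> mu (A i) (e i) t" if "i \<in> I" for i t
      using abs_le_D2[OF amp_bounds(3)[where A = "A i" and e = "e i" and t = t and mu = mu,
            OF \<kappa> B[OF that] e[rule_format, OF that]]] \<open>64 * B \<le> \<kappa> + mu\<close> by (simp add: field_simps)
  qed (use that in simp)
qed

text \<open>The two scalar equations are the components along \<open>e\<close> and \<open>perp e\<close> of the vector equation.\<close>

lemma dispersion_relation:
  assumes e: "e \<bullet> e = 1"
    and root: "symb A e e (perp e) t * a\<^sup>2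
      - (\<kappa> + symb A e (perp e) (perp e) t - symb A e e e t) * a - symb A e (perp e) e t = 0"
  defines "v \<equiv> e + a *\<^sub>R perp e"
  shows "(\<kappa> + mu - symb A e e e t - symb A e e (perp e) t * a) * v $ k =
    mu * v $ k + \<kappa> * e $ k - (\<Sum>m\<in>UNIV. \<Sum>n\<in>UNIV. \<Sum>r\<in>UNIV. A k m n r t * (e $ n * e $ r * v $ m))"
proof -
  define R where "R k = (\<Sum>m\<in>UNIV. \<Sum>n\<in>UNIV. \<Sum>r\<in>UNIV. A k m n r t * (e $ n * e $ r * v $ m))" for k
  have v: "v $ m = e $ m + a * perp e $ m" for m
    by (simp add: v_def)
  have R: "(\<Sum>k\<in>UNIV. u $ k * R k) = symb A e u e t + symb A e u (perp e) t * a" for u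
    unfolding R_def symb_def v
    by (simp add: sum_distrib_left sum_distrib_right algebra_simps flip: sum.distrib)
  have e1: "e $ 1 * e $ 1 + e $ 2 * e $ 2 = 1"
    using e by (simp add: inner_vec_def sum_2)
  have R1: "e $ 1 * R 1 + e $ 2 * R 2 = symb A e e e t + symb A e e (perp e) t * a"
    using R[of e] by (simp add: sum_2)
  have R2: "- e $ 2 * R 1 + e $ 1 * R 2 = symb A e (perp e) e t + symb A e (perp e) (perp e) t * a"
    using R[of "perp e"] by (simp add: sum_2 perp_def)
  define p where "p = symb A e e e t + symb A e e (perp e) t * a"
  \<comment> \<open>The quadratic equation says that the component along \<open>perp e\<close> of
    the matrix applied to \<open>v\<close> is (p - \<kappa>) a.\<close>
  have q: "symb A e (perp e) e t + symb A e (perp e) (perp e) t * a = p * a - \<kappa> * a"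
    using root by (simp add: p_def algebra_simps power2_eq_square)
  \<comment> \<open>\<open>R\<close> is recovered from its components in the orthonormal basis
    \<open>e\<close>, \<open>perp e\<close>.\<close>
  have "R 1 = (e $ 1 * R 1 + e $ 2 * R 2) * e $ 1 - (- e $ 2 * R 1 + e $ 1 * R 2) * e $ 2"
    using e1 by algebra
  then have 1: "R 1 = p * e $ 1 - (p * a - \<kappa> * a) * e $ 2"
    unfolding R1 R2 q p_def[symmetric] .
  have "R 2 = (e $ 1 * R 1 + e $ 2 * R 2) * e $ 2 + (- e $ 2 * R 1 + e $ 1 * R 2) * e $ 1"
    using e1 by algebra
  then have 2: "R 2 = p * e $ 2 + (p * a - \<kappa> * a) * e $ 1"
    unfolding R1 R2 q p_def[symmetric] .
  have "(\<kappa> + mu - p) * v $ k = mu * v $ k + \<kappa> * e $ k - R k"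
    using exhaust_2[of k] by (auto simp: v perp_def 1 2 algebra_simps)
  then show ?thesis
    by (simp add: R_def p_def diff_diff_add)
qed

lemma antiderivative_UNIV:
  fixes g :: "real \<Rightarrow> real"
  assumes "continuous_on UNIV g"
  obtains c where "c 0 = 0" "\<And>t. (c has_real_derivative g t) (at t)"
proof -
  have "isCont g x" for x
    using assms by (simp add: continuous_on_eq_continuous_at)
  then obtain G where G: "\<And>t. (G has_vector_derivative g t) (at t)"
    using einterval_antiderivative[of "-\<infinity>" "\<infinity>" g] by auto
  have "((\<lambda>t. G t - G 0) has_real_derivative g t) (at t)" for t
    using G[of t] by (auto intro!: derivative_eq_intros simp: has_real_derivative_iff_has_vector_derivative)
  then show thesis
    using that[of "\<lambda>t. G t - G 0"] by simp
qed

section \<open>The approximate solutions\<close>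

text \<open>The order of the quantifiers encodes the dependence of the constants:
  \<open>\<epsilon>2\<close> and \<open>K\<close> are fixed before \<open>L\<close>,
  \<open>KL\<close> may depend on \<open>L\<close>, and all of them precede \<open>f\<close>,
  \<open>lt\<close>, \<open>A\<close>, \<open>A0\<close>, \<open>lA\<close> and \<epsilon>.\<close>

theorem lemma6p1:
  fixes lam mu C :: real
  assumes "mu > 0" and "lam + 2 * mu > 0" and "lam + mu \<noteq> 0" and "C > 0"
  shows "\<exists>\<epsilon>2>0. \<exists>K>0. \<forall>L\<ge>2. \<exists>KL>0.
    \<forall>(f :: int^2) (lt :: nat) (A :: 2 \<Rightarrow> 2 \<Rightarrow> 2 \<Rightarrow> 2 \<Rightarrow> real \<Rightarrow> real) (A0 :: real) (lA :: real) (\<epsilon> :: real).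
      f \<noteq> 0 \<longrightarrow> lt > 0 \<longrightarrow> 0 < A0 \<longrightarrow> A0 \<le> 1 \<longrightarrow> 1 \<le> lA \<longrightarrow> 0 < \<epsilon> \<longrightarrow> \<epsilon> < \<epsilon>2 \<longrightarrow>
      (\<forall>k m n r. CN_fun L (A k m n r)) \<longrightarrow>
      (\<forall>k m n r. CN_norm 0 (A k m n r) \<le> ereal (C * \<epsilon>)) \<longrightarrow>
      (\<forall>k m n r. \<forall>N\<in>{1..L}. CN_norm N (A k m n r) \<le> ereal (A0 * lA ^ N)) \<longrightarrow>
      (let F = vec_of_int f in
       \<exists>(a :: real \<Rightarrow> real) (c :: real \<Rightarrow> real).
         CN_fun L a \<and> CN_fun (L + 1) c \<and> c 0 = 0 \<and>
         CN_norm 0 a \<le> ereal (K * \<epsilon>) \<and>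
         CN_norm 0 a \<le> ereal (1 / 10) \<and>
         (\<forall>N\<in>{1..L}. CN_norm N a \<le> ereal (KL * (A0 * lA ^ N))) \<and>
         CN_norm 0 (\<lambda>t. deriv c t - sqrt (lam + 2 * mu) * norm F) \<le> ereal (K * (\<epsilon> * norm F)) \<and>
         (\<forall>N\<in>{2..L}. CN_norm 0 ((deriv ^^ N) c) \<le> ereal (KL * (A0 * lA ^ (N - 1) * norm F))) \<and>
         solves lam mu A (w_wave lt F a c) (w_error lt F a c) \<and>
         solves lam mu A (\<lambda>t x. cnj_vec (w_wave lt F a c t x)) (\<lambda>t x. cnj_vec (w_error lt F a c t x)) \<and>
         (\<forall>t x. w_wave lt F a c t x + cnj_vec (w_wave lt F a c t x)
                  = cvec (2 *\<^sub>R Re_vec (w_wave lt F a c t x))) \<and>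
         solves lam mu A (\<lambda>t x. 2 *\<^sub>R Re_vec (w_wave lt F a c t x))
                         (\<lambda>t x. 2 *\<^sub>R Re_vec (w_error lt F a c t x)))"
proof -
  define \<kappa> where "\<kappa> = lam + mu"
  define s0 where "s0 = lam + 2 * mu"
  \<comment> \<open>\<open>B\<close> is the admissible size of C \<epsilon>: the first entry serves
    the small root, the second keeps the squared speed above s0 / 2, and the 1 matches the weight of
    order zero.\<close>
  define B where "B = min (min (\<bar>\<kappa>\<bar> / 640) (s0 / 64)) 1"
  \<comment> \<open>The entries come from the amplitude bound and from the deviation of the speed,
    where the square root costs a division by \<open>sqrt s0\<close>.\<close>
  define K where "K = max (64 / \<bar>\<kappa>\<bar> * C) (32 * C / sqrt s0)"
  have \<kappa>: "\<kappa> \<noteq> 0" "40 * (16 * B) \<le> \<bar>\<kappa>\<bar>" and s0: "\<kappa> + mu = s0" "0 < s0" "64 * B \<le> s0"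
    and B: "0 < B" "B \<le> 1"
    using assms by (auto simp: \<kappa>_def s0_def B_def min_def)
  have K: "0 < K"
    using assms(4) \<kappa> by (auto simp: K_def less_max_iff_disj)
  let "\<exists>\<epsilon>2>0. \<exists>K>0. \<forall>L\<ge>2. \<exists>KL>0. ?P \<epsilon>2 K L KL" = ?thesis
  have main: "\<exists>KL>0. ?P (B / C) K L KL"
    if L: "L \<ge> 2" for L
  proof -
    \<comment> \<open>The index collects the data on which the constants must not depend.\<close>
    define adm where "adm = (\<lambda>(f :: int^2, A :: 2 \<Rightarrow> 2 \<Rightarrow> 2 \<Rightarrow> 2 \<Rightarrow> real \<Rightarrow> real, A0 :: real, lA :: real).
      f \<noteq> 0 \<and> 0 < A0 \<and> A0 \<le> 1 \<and> 1 \<le> lA \<and>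
      (\<forall>k m n r. CN_fun L (A k m n r) \<and> CN_norm 0 (A k m n r) \<le> ereal B \<and>
        (\<forall>N\<in>{1..L}. CN_norm N (A k m n r) \<le> ereal (A0 * lA ^ N))))"
    define I where "I = Collect adm"
    define W where "W = (\<lambda>(f :: int^2, A :: 2 \<Rightarrow> 2 \<Rightarrow> 2 \<Rightarrow> 2 \<Rightarrow> real \<Rightarrow> real, A0 :: real, lA :: real) j.
      if j = 0 then 1 else A0 * lA ^ j)"
    define e where "e = (\<lambda>(f :: int^2, A :: 2 \<Rightarrow> 2 \<Rightarrow> 2 \<Rightarrow> 2 \<Rightarrow> real \<Rightarrow> real, A0 :: real, lA :: real).
      (1 / norm (vec_of_int f)) *\<^sub>R vec_of_int f)"
    define coef where "coef = (\<lambda>(f :: int^2, A :: 2 \<Rightarrow> 2 \<Rightarrow> 2 \<Rightarrow> 2 \<Rightarrow> real \<Rightarrow> real, A0 :: real, lA :: real). A)"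
    interpret alg_weight I W
    proof
      \<comment> \<open>Here \<open>A0 \<le> 1\<close> enters: a product of two weights carries
        \<open>A0\<close> twice.\<close>
      have "A0 * x * (A0 * y) \<le> A0 * (x * y)" if "0 < A0" "A0 \<le> 1" "0 < x" "0 < y" for A0 x y :: real
        using mult_right_mono[of A0 1 "A0 * (x * y)"] that by (simp add: mult_ac)
      then show "\<forall>i\<in>I. \<forall>j k. W i j * W i k \<le> W i (j + k)"
        by (auto simp: W_def I_def adm_def power_add)
    qed (auto simp: W_def I_def adm_def)
    have coef_le: "\<bar>coef i k m n r t\<bar> \<le> B" if "i \<in> I" for i k m n r t
      using that CN_norm_leD[of 0 "coef i k m n r" B 0 t] by (auto simp: I_def adm_def coef_def)
    have coef: "unif_bounded I W L (\<lambda>i. coef i k m n r)" for k m n r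
      unfolding unif_bounded_def
    proof (intro conjI exI[of _ 1] ballI allI impI)
      fix i j t assume i: "i \<in> I" and j: "j \<le> L"
      show "\<bar>(deriv ^^ j) (coef i k m n r) t\<bar> \<le> 1 * W i j"
      proof (cases "j = 0")
        case True
        then show ?thesis using coef_le[OF i, of k m n r t] B zero i by simp
      next
        case False
        obtain f A A0 lA where i_eq: "i = (f, A, A0, lA)" by (cases i)
        have "CN_norm j (A k m n r) \<le> ereal (A0 * lA ^ j)"
          using i j False by (simp add: I_def adm_def i_eq)
        from CN_norm_leD[OF this order_refl] show ?thesis
          using False by (simp add: i_eq coef_def W_def)
      qed
    qed (auto simp: I_def adm_def coef_def)
    have norm_pos: "0 < norm (vec_of_int f)" if "f \<noteq> 0" for f
      using that by (auto simp: vec_of_int_def vec_eq_iff)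
    have e_unit: "e i \<bullet> e i = 1" if "i \<in> I" for i
      using that norm_pos by (auto simp: e_def I_def adm_def dot_square_norm power2_eq_square)
    have e_le: "\<forall>i\<in>I. \<forall>k. \<bar>e i $ k\<bar> \<le> 1"
      using e_unit component_le_norm_cart by (metis norm_eq_1)

    \<comment> \<open>Uniform derivative bounds for amplitude and speed\<close>
    let ?a = "\<lambda>i. amp \<kappa> (coef i) (e i)" and ?s = "\<lambda>i t. sqrt (speed2 \<kappa> mu (coef i) (e i) t)"
    have a: "unif_bounded I W L ?a" and s: "unif_bounded I W L ?s"
      using unif_bounded_amp[OF coef e_le coef_le \<kappa>] s0 by auto
    define nF where "nF = (\<lambda>(f :: int^2, A :: 2 \<Rightarrow> 2 \<Rightarrow> 2 \<Rightarrow> 2 \<Rightarrow> real \<Rightarrow> real, A0 :: real, lA :: real). norm (vec_of_int f))"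
    \<comment> \<open>The norm of \<open>f\<close> is unbounded over the family, so it goes into the
      weight. Concentrating that weight at order zero makes the product weight exactly
      \<open>nF i * W i j\<close>.\<close>
    have "unif_bounded I (\<lambda>i j. if j = 0 then nF i else 0) L (\<lambda>i t. nF i)"
      by (rule unif_bounded_const[of _ _ _ 1]) (auto simp: nF_def)
    then have g: "unif_bounded I (\<lambda>i j. nF i * W i j) L (\<lambda>i t. nF i * ?s i t)"
      using nonneg zero by (intro unif_bounded_mult[OF _ _ _ _ s]) (auto simp: nF_def)
    obtain R where R: "\<And>i j t. i \<in> I \<Longrightarrow> j \<le> L \<Longrightarrow> \<bar>(deriv ^^ j) (?a i) t\<bar> \<le> R * W i j"
      using a unfolding unif_bounded_def by blast
    obtain S where S: "\<And>i j t. i \<in> I \<Longrightarrow> j \<le> L \<Longrightarrow> \<bar>(deriv ^^ j) (\<lambda>t. nF i * ?s i t) t\<bar> \<le> S * (nF i * W i j)"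
      using g unfolding unif_bounded_def by blast
    \<comment> \<open>The last entry serves the order zero part of the norms of \<open>a\<close>,
      which \<open>R * W i 0\<close> does not bound by \<open>A0\<close>.\<close>
    define Q where "Q = max (max \<bar>R\<bar> \<bar>S\<bar>) (64 / \<bar>\<kappa>\<bar>)"
    have Q: "0 < Q" "R \<le> Q" "S \<le> Q" "64 / \<bar>\<kappa>\<bar> \<le> Q"
      using \<kappa> by (auto simp: Q_def less_max_iff_disj)
    show ?thesis
    proof (intro exI[of _ "(real L + 1) * Q"] conjI allI impI)
      show "0 < (real L + 1) * Q" using Q by simp

      \<comment> \<open>Estimates for fixed data\<close>
      fix f :: "int^2" and lt :: nat and A :: "2 \<Rightarrow> 2 \<Rightarrow> 2 \<Rightarrow> 2 \<Rightarrow> real \<Rightarrow> real" and A0 lA \<epsilon> :: real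
      assume f: "f \<noteq> 0" and A0: "0 < A0" "A0 \<le> 1" and lA: "1 \<le> lA" and \<epsilon>: "0 < \<epsilon>" "\<epsilon> < B / C"
        and A: "\<forall>k m n r. CN_fun L (A k m n r)" "\<forall>k m n r. CN_norm 0 (A k m n r) \<le> ereal (C * \<epsilon>)"
          "\<forall>k m n r. \<forall>N\<in>{1..L}. CN_norm N (A k m n r) \<le> ereal (A0 * lA ^ N)"
      define i where "i = (f, A, A0, lA)"
      define F where "F = vec_of_int f"
      define E where "E = e i"
      define \<alpha> where "\<alpha> = amp \<kappa> A E"
      have C\<epsilon>: "C * \<epsilon> \<le> B"
        using \<epsilon> assms(4) by (simp add: field_simps)
      have i: "i \<in> I"
        using f A0 lA A C\<epsilon> order_trans[of _ "ereal (C * \<epsilon>)" "ereal B"] by (auto simp: I_def adm_def i_def)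
      have coef_i: "coef i = A" and nF_i: "nF i = norm F" and W_i: "W i j = (if j = 0 then 1 else A0 * lA ^ j)" for j
        by (auto simp: i_def coef_def W_def nF_def F_def)
      have F_pos: "0 < norm F" and F: "F = norm F *\<^sub>R E"
        using norm_pos[OF f] by (auto simp: F_def E_def e_def i_def)
      have E: "E \<bullet> E = 1" and E_le: "\<bar>E $ k\<bar> \<le> 1" for k
        using e_unit[OF i] e_le i by (auto simp: E_def)
      define \<sigma> where "\<sigma> t = speed2 \<kappa> mu A E t" for t
      have A_le: "\<bar>A k m n r t\<bar> \<le> C * \<epsilon>" "\<bar>A k m n r t\<bar> \<le> A0 * lA" for k m n r t
        using CN_norm_leD[of 0 "A k m n r" "C * \<epsilon>" 0 t] CN_norm_leD[of 1 "A k m n r" "A0 * lA" 0 t]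
          A(2) A(3)[rule_format, of 1 k m n r] L by auto
      have \<kappa>': "40 * (16 * (C * \<epsilon>)) \<le> \<bar>\<kappa>\<bar>"
        using \<kappa>(2) C\<epsilon> by linarith
      note \<alpha>_le = amp_bounds(1,2)[where A = A and e = E, OF \<kappa>(1) \<kappa>' A_le(1) E_le, folded \<alpha>_def]
      note \<sigma>_near = amp_bounds(3)[where A = A and e = E and mu = mu, OF \<kappa>(1) \<kappa>' A_le(1) E_le, folded \<sigma>_def]
      \<comment> \<open>The norm of order N contains the supremum of \<open>a\<close>, which
        therefore needs a bound by \<open>A0 * lA\<close> besides the one by \<epsilon>. If
        \<open>A0 * lA\<close> is the smaller one, it can replace C \<epsilon> in the amplitude
        bound; otherwise the bound by \<epsilon> is the stronger one.\<close>
      have \<alpha>_A0: "\<bar>\<alpha> t\<bar> \<le> Q * (A0 * lA)" for t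
      proof -
        have "\<bar>\<alpha> t\<bar> \<le> 64 / \<bar>\<kappa>\<bar> * (A0 * lA)"
        proof (cases "A0 * lA \<le> C * \<epsilon>")
          case True
          then show ?thesis
            using amp_bounds(1)[where A = A and e = E, OF \<kappa>(1) _ A_le(2) E_le] \<kappa>' by (simp add: \<alpha>_def)
        next
          case False
          then have "64 / \<bar>\<kappa>\<bar> * (C * \<epsilon>) \<le> 64 / \<bar>\<kappa>\<bar> * (A0 * lA)"
            by (intro mult_left_mono) auto
          then show ?thesis using \<alpha>_le(1)[of t] by linarith
        qed
        also have "\<dots> \<le> Q * (A0 * lA)"
          using Q A0 lA by (intro mult_right_mono) auto
        finally show ?thesis .
      qed
      have \<sigma>: "s0 / 2 \<le> \<sigma> t" for t
        using abs_le_D2[OF \<sigma>_near[of t]] C\<epsilon> s0 by linarith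
      define g where "g t = norm F * sqrt (\<sigma> t)" for t
      have g_eq: "(\<lambda>t. nF i * ?s i t) = g"
        by (simp add: g_def[abs_def] \<sigma>_def E_def coef_i nF_i)
      have CN_a: "CN_fun L \<alpha>"
        using a i by (auto simp: unif_bounded_def \<alpha>_def E_def coef_i)
      have CN_g: "CN_fun L g"
        using g i g_eq unfolding unif_bounded_def by metis
      \<comment> \<open>Integrating \<open>g\<close> gains one derivative for
        \<open>c\<close>.\<close>
      obtain c where c0: "c 0 = 0" and c: "\<And>t. (c has_real_derivative g t) (at t)"
        using antiderivative_UNIV[OF CN_fun_continuous[OF CN_g]] by blast
      note c_deriv = differentiable_on_UNIV_I[OF c]
      have CN_c: "CN_fun (L + 1) c"
        using c_deriv CN_g by (simp add: CN_fun_Suc)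
      have a_N: "CN_norm N \<alpha> \<le> ereal ((real L + 1) * Q * (A0 * lA ^ N))" if N: "N \<in> {1..L}" for N
      proof -
        have "\<bar>(deriv ^^ j) \<alpha> t\<bar> \<le> Q * (A0 * lA ^ N)" if j: "j \<le> N" for j t
        proof (cases "j = 0")
          case True
          have "Q * (A0 * lA) \<le> Q * (A0 * lA ^ N)"
            using N Q A0 lA by (intro mult_left_mono self_le_power) auto
          then show ?thesis using \<alpha>_A0[of t] True by simp
        next
          case False
          have "\<bar>(deriv ^^ j) \<alpha> t\<bar> \<le> R * (A0 * lA ^ j)"
            using R[OF i, of j t] j N False by (simp add: W_i \<alpha>_def E_def coef_i)
          also have "\<dots> \<le> Q * (A0 * lA ^ N)"
            using Q A0 lA j by (intro mult_mono power_increasing) auto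
          finally show ?thesis .
        qed
        then have "CN_norm N \<alpha> \<le> ereal (real (Suc N) * (Q * (A0 * lA ^ N)))"
          by (intro CN_norm_leI)
        also have "\<dots> \<le> ereal ((real L + 1) * Q * (A0 * lA ^ N))"
          using N Q A0 lA by (simp add: mult.assoc)
        finally show ?thesis .
      qed
      have c_N: "CN_norm 0 ((deriv ^^ N) c) \<le> ereal ((real L + 1) * Q * (A0 * lA ^ (N - 1) * norm F))"
        if N: "N \<in> {2..L}" for N
      proof (rule CN_norm_0_leI)
        fix t
        \<comment> \<open>The derivative of order N of \<open>c\<close> is that of order N - 1 of
          \<open>g\<close>; as N is at least 2, this order is positive and its weight contains
          \<open>A0\<close>.\<close>
        obtain j where j: "N = Suc j" "1 \<le> j" "j \<le> L"
          using N by (cases N) auto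
        have "\<bar>(deriv ^^ N) c t\<bar> = \<bar>(deriv ^^ j) g t\<bar>"
          by (simp add: j funpow_Suc_right c_deriv del: funpow.simps(2))
        also have "\<dots> \<le> S * (norm F * (A0 * lA ^ j))"
          using S[OF i j(3), of t] j unfolding g_eq by (simp add: W_i nF_i)
        also have "\<dots> \<le> ((real L + 1) * Q) * (norm F * (A0 * lA ^ j))"
        proof (intro mult_right_mono)
          have "1 * Q \<le> (real L + 1) * Q"
            using Q by (intro mult_right_mono) auto
          then show "S \<le> (real L + 1) * Q" using Q by linarith
        qed (use A0 lA in simp)
        finally show "\<bar>(deriv ^^ N) c t\<bar> \<le> (real L + 1) * Q * (A0 * lA ^ (N - 1) * norm F)"
          by (simp add: j mult_ac)
      qed
      have c_speed: "CN_norm 0 (\<lambda>t. deriv c t - sqrt (lam + 2 * mu) * norm F) \<le> ereal (K * (\<epsilon> * norm F))"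
      proof (rule CN_norm_0_leI)
        fix t
        have pos: "0 < sqrt s0" "0 \<le> sqrt (\<sigma> t)"
          using s0 \<sigma>[of t] by auto
        \<comment> \<open>A difference of square roots is the difference of the radicands over their
          sum, which is at least \<open>sqrt s0\<close>.\<close>
        have "(sqrt (\<sigma> t) - sqrt s0) * (sqrt (\<sigma> t) + sqrt s0) = \<sigma> t - s0"
          using s0 \<sigma>[of t] by (simp add: algebra_simps)
        then have "\<bar>sqrt (\<sigma> t) - sqrt s0\<bar> * (sqrt (\<sigma> t) + sqrt s0) \<le> 32 * (C * \<epsilon>)"
          using \<sigma>_near[of t] s0(1) pos by (metis abs_mult abs_of_pos add_nonneg_pos)
        moreover have "\<bar>sqrt (\<sigma> t) - sqrt s0\<bar> * sqrt s0 \<le> \<bar>sqrt (\<sigma> t) - sqrt s0\<bar> * (sqrt (\<sigma> t) + sqrt s0)"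
          using pos by (intro mult_left_mono) auto
        ultimately have "\<bar>sqrt (\<sigma> t) - sqrt s0\<bar> * sqrt s0 \<le> 32 * (C * \<epsilon>)"
          by (rule order_trans[rotated])
        then have "\<bar>sqrt (\<sigma> t) - sqrt s0\<bar> \<le> (32 * C / sqrt s0) * \<epsilon>"
          using pos by (simp add: field_simps)
        also have "\<dots> \<le> K * \<epsilon>"
          using \<epsilon> by (intro mult_right_mono) (auto simp: K_def)
        finally have "norm F * \<bar>sqrt (\<sigma> t) - sqrt s0\<bar> \<le> norm F * (K * \<epsilon>)"
          by (intro mult_left_mono) auto
        moreover have "deriv c t - sqrt (lam + 2 * mu) * norm F = norm F * (sqrt (\<sigma> t) - sqrt s0)"
          by (simp add: c_deriv g_def s0_def algebra_simps)
        ultimately show "\<bar>deriv c t - sqrt (lam + 2 * mu) * norm F\<bar> \<le> K * (\<epsilon> * norm F)"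
          by (simp add: abs_mult mult_ac)
      qed
      have a_0: "CN_norm 0 \<alpha> \<le> ereal (K * \<epsilon>)"
      proof (rule CN_norm_0_leI)
        fix t
        have "\<bar>\<alpha> t\<bar> \<le> (64 / \<bar>\<kappa>\<bar> * C) * \<epsilon>"
          using \<alpha>_le(1)[of t] by (simp add: mult_ac)
        also have "\<dots> \<le> K * \<epsilon>"
          using \<epsilon> by (intro mult_right_mono) (auto simp: K_def)
        finally show "\<bar>\<alpha> t\<bar> \<le> K * \<epsilon>" .
      qed
      have D2: "\<And>t. (h has_real_derivative deriv h t) (at t)"
        "\<And>t. (deriv h has_real_derivative deriv (deriv h) t) (at t)" if "CN_fun L h" for h
      proof -
        obtain L' where "L = Suc (Suc L')"
          using L by (metis add_2_eq_Suc le_Suc_ex)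
        then show "\<And>t. (h has_real_derivative deriv h t) (at t)"
          "\<And>t. (deriv h has_real_derivative deriv (deriv h) t) (at t)"
          using that by (auto simp: CN_fun_Suc intro: differentiable_on_UNIV_deriv)
      qed

      \<comment> \<open>The equation and its conjugate and real forms\<close>
      have sol: "solves lam mu A (w_wave lt F \<alpha> c) (w_error lt F \<alpha> c)"
        unfolding F_def
      proof (rule solves_w_wave[OF D2[OF CN_a] c D2(1)[OF CN_g]], fold F_def)
        fix t k
        have "\<sigma> t * (E + \<alpha> t *\<^sub>R perp E) $ k = mu * (E + \<alpha> t *\<^sub>R perp E) $ k + \<kappa> * E $ k -
          (\<Sum>m\<in>UNIV. \<Sum>n\<in>UNIV. \<Sum>r\<in>UNIV. A k m n r t * (E $ n * E $ r * (E + \<alpha> t *\<^sub>R perp E) $ m))"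
        proof -
          have P_le: "\<bar>perp E $ k\<bar> \<le> 1" for k
            by (rule abs_perp_nth_le[OF E_le])
          note m = abs_symb_le[of A t "C * \<epsilon>" E, OF A_le(1) E_le]
          note R = small_root_perturbation(3)[OF \<kappa>(1) \<kappa>' m[OF E_le E_le] m[OF E_le P_le] m[OF P_le E_le] m[OF P_le P_le],
              folded amp_def, folded \<alpha>_def]
          show ?thesis
            using dispersion_relation[OF E R] unfolding \<sigma>_def speed2_def \<alpha>_def .
        qed
        note * = this
        show "(g t)\<^sup>2 * (F + \<alpha> t *\<^sub>R perp F) $ k =
          mu * (F \<bullet> F) * (F + \<alpha> t *\<^sub>R perp F) $ k + (lam + mu) * (F \<bullet> F) * F $ k
          - (\<Sum>m\<in>UNIV. \<Sum>n\<in>UNIV. \<Sum>r\<in>UNIV. A k m n r t * (F $ n * F $ r * (F + \<alpha> t *\<^sub>R perp F) $ m))"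
          (is "?lhs = ?rhs")
        proof -
          \<comment> \<open>Both sides are homogeneous of degree three in \<open>F\<close>, so the
            relation for the unit vector \<open>E\<close> is multiplied by the cube of the
            norm.\<close>
          define v where "v = E + \<alpha> t *\<^sub>R perp E"
          have v: "F + \<alpha> t *\<^sub>R perp F = norm F *\<^sub>R v"
          proof -
            have "perp (r *\<^sub>R x) = r *\<^sub>R perp x" for r x
              by (simp add: perp_def vec_eq_iff forall_2)
            then show ?thesis
              by (subst (1 2) F) (simp add: v_def algebra_simps)
          qed
          have Fk: "F $ j = norm F * E $ j" for j
            by (subst F) simp
          have FF: "F \<bullet> F = (norm F)\<^sup>2"
            by (simp add: dot_square_norm)
          have gt: "(g t)\<^sup>2 = (norm F)\<^sup>2 * \<sigma> t"
            using \<sigma>[of t] s0 by (simp add: g_def power_mult_distrib)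
          have "?lhs = (norm F) ^ 3 * (\<sigma> t * v $ k)"
            unfolding gt v by (simp add: power3_eq_cube power2_eq_square)
          also have "\<dots> = (norm F) ^ 3 * (mu * v $ k + \<kappa> * E $ k -
              (\<Sum>m\<in>UNIV. \<Sum>n\<in>UNIV. \<Sum>r\<in>UNIV. A k m n r t * (E $ n * E $ r * v $ m)))"
            using * unfolding v_def by simp
          also have "\<dots> = ?rhs"
            unfolding v FF \<kappa>_def vector_scaleR_component Fk
            by (simp add: power3_eq_cube power2_eq_square algebra_simps sum_distrib_left)
          finally show ?thesis .
        qed
      qed
      have cnj_sol: "solves lam mu A (\<lambda>t x. cnj_vec (w_wave lt F \<alpha> c t x)) (\<lambda>t x. cnj_vec (w_error lt F \<alpha> c t x))"
        using solves_bounded_linear[OF sol bounded_linear_cnj] by (simp add: cnj_vec_def)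
      have Re_sol: "solves lam mu A (\<lambda>t x. 2 *\<^sub>R Re_vec (w_wave lt F \<alpha> c t x)) (\<lambda>t x. 2 *\<^sub>R Re_vec (w_error lt F \<alpha> c t x))"
      proof -
        have "2 *\<^sub>R Re_vec z = (\<chi> k. 2 *\<^sub>R Re (z $ k))" for z
          by (simp add: vec_eq_iff Re_vec_def)
        then show ?thesis
          using solves_bounded_linear[OF sol bounded_linear_scaleR_right[THEN bounded_linear_compose, OF bounded_linear_Re, of 2]]
          by simp
      qed
      have sum: "z + cnj_vec z = cvec (2 *\<^sub>R Re_vec z)" for z
        by (simp add: vec_eq_iff cnj_vec_def cvec_def Re_vec_def complex_add_cnj)
      show "let F = vec_of_int f in
       \<exists>(a :: real \<Rightarrow> real) (c :: real \<Rightarrow> real).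
         CN_fun L a \<and> CN_fun (L + 1) c \<and> c 0 = 0 \<and>
         CN_norm 0 a \<le> ereal (K * \<epsilon>) \<and>
         CN_norm 0 a \<le> ereal (1 / 10) \<and>
         (\<forall>N\<in>{1..L}. CN_norm N a \<le> ereal ((real L + 1) * Q * (A0 * lA ^ N))) \<and>
         CN_norm 0 (\<lambda>t. deriv c t - sqrt (lam + 2 * mu) * norm F) \<le> ereal (K * (\<epsilon> * norm F)) \<and>
         (\<forall>N\<in>{2..L}. CN_norm 0 ((deriv ^^ N) c) \<le> ereal ((real L + 1) * Q * (A0 * lA ^ (N - 1) * norm F))) \<and>
         solves lam mu A (w_wave lt F a c) (w_error lt F a c) \<and>
         solves lam mu A (\<lambda>t x. cnj_vec (w_wave lt F a c t x)) (\<lambda>t x. cnj_vec (w_error lt F a c t x)) \<and>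
         (\<forall>t x. w_wave lt F a c t x + cnj_vec (w_wave lt F a c t x)
                  = cvec (2 *\<^sub>R Re_vec (w_wave lt F a c t x))) \<and>
         solves lam mu A (\<lambda>t x. 2 *\<^sub>R Re_vec (w_wave lt F a c t x))
                         (\<lambda>t x. 2 *\<^sub>R Re_vec (w_error lt F a c t x))"
        unfolding Let_def F_def[symmetric]
        by (rule exI[of _ \<alpha>], rule exI[of _ c])
           (intro conjI ballI allI CN_a CN_c c0 a_0 CN_norm_0_leI[of \<alpha>, OF \<alpha>_le(2)] a_N c_speed c_N
             sol cnj_sol sum Re_sol)
    qed
  qed
  have "0 < B / C" using B assms(4) by simp
  with K main show ?thesis by blast
qed

end
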